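(* Let $\lambda>\sqrt{24}$ and let $H$ be the operator on $\ell^2(\mathbb{Z})$ given by $[Hu](n)=u(n+1)+u(n-1)+V(n)u(n)$ with $$V(n)=\lambda\,\chi_{[1-\phi^{-1},1)}(n\phi^{-1} \bmod 1),\qquad \phi=\frac{\sqrt5+1}{2}$$ (the Fibonacci Hamiltonian with phase $\theta=0$). Let $S_u(\lambda)=2\lambda+22$. Then $$\langle\beta^-_{\delta_0}(p)\rangle\ge\frac{2\log\phi}{\log S_u(\lambda)}-\frac2p\left(1-\frac{2\log\frac{\sqrt{17}}{4}}{5\log S_u(\lambda)}\right)$$ for every $p>0$.
   Context: $\{\delta_n\}_{n\in\mathbb{Z}}$ is the standard basis of $\ell^2(\mathbb{Z})$ and $\chi_A$ is the indicator function of $A$. Time averages: for a function $f$ of $t>0$ and $T>0$, $\langle f\rangle(T)=\frac2T\int_0^\infty e^{-2t/T}f(t)\,dt$. Moments and transport exponent: for $p>0$, $\langle|X|^p_{\delta_0}\rangle(t)=\sum_{n\in\mathbb{Z}}|n|^p|\langle e^{-itH}\delta_0,\delta_n\rangle|^2$, with time average $\langle\langle|X|^p_{\delta_0}\rangle\rangle(T)$, and $$\langle\beta^-_{\delta_0}(p)\rangle=\liminf_{T\to\infty}\frac{\log\langle\langle|X|^p_{\delta_0}\rangle\rangle(T)}{p\log T}.$$ *)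

theory Defs
  imports "HOL-Analysis.Analysis"
begin

section \<open>The Hilbert space of square-summable sequences over the integers\<close>

typedef ell2 = "{u :: int \<Rightarrow> complex. (\<lambda>n. (cmod (u n))\<^sup>2) summable_on UNIV}"
  morphisms ell2_nth Abs_ell2
  by (rule exI[of _ "\<lambda>_. 0"]) simp

setup_lifting type_definition_ell2

notation ell2_nth (infixl "$$" 90)

lemma ell2_eqI: "(\<And>n. u $$ n = v $$ n) \<Longrightarrow> u = v"
  by transfer auto

lemma ell2_summable: "(\<lambda>n. (cmod (u $$ n))\<^sup>2) summable_on UNIV"
  by transfer simp

lemma square_summable_add:
  fixes u v :: "int \<Rightarrow> complex"
  assumes "(\<lambda>n. (cmod (u n))\<^sup>2) summable_on UNIV" "(\<lambda>n. (cmod (v n))\<^sup>2) summable_on UNIV"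
  shows "(\<lambda>n. (cmod (u n + v n))\<^sup>2) summable_on UNIV"
proof (rule summable_on_comparison_test)
  show "(\<lambda>n. 2 * (cmod (u n))\<^sup>2 + 2 * (cmod (v n))\<^sup>2) summable_on UNIV"
    by (intro summable_on_add summable_on_cmult_right assms)
  fix n
  have "(cmod (u n + v n))\<^sup>2 \<le> (cmod (u n) + cmod (v n))\<^sup>2"
    by (intro power_mono norm_triangle_ineq norm_ge_zero)
  also have "\<dots> \<le> 2 * (cmod (u n))\<^sup>2 + 2 * (cmod (v n))\<^sup>2"
    using sum_squares_bound[of "cmod (u n)" "cmod (v n)"] by (simp add: power2_sum)
  finally show "(cmod (u n + v n))\<^sup>2 \<le> 2 * (cmod (u n))\<^sup>2 + 2 * (cmod (v n))\<^sup>2" .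
qed simp_all

lemma square_summable_mult:
  fixes u c :: "int \<Rightarrow> complex"
  assumes "(\<lambda>n. (cmod (u n))\<^sup>2) summable_on UNIV" "\<And>n. cmod (c n) \<le> B"
  shows "(\<lambda>n. (cmod (c n * u n))\<^sup>2) summable_on UNIV"
proof (rule summable_on_comparison_test)
  show "(\<lambda>n. B\<^sup>2 * (cmod (u n))\<^sup>2) summable_on UNIV"
    by (intro summable_on_cmult_right assms)
  fix n
  show "(cmod (c n * u n))\<^sup>2 \<le> B\<^sup>2 * (cmod (u n))\<^sup>2"
    using assms(2)[of n] by (simp add: norm_mult power_mult_distrib mult_right_mono power_mono)
qed simp_all

lemma square_summable_shift:
  fixes u :: "int \<Rightarrow> complex"
  assumes "(\<lambda>n. (cmod (u n))\<^sup>2) summable_on UNIV"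
  shows "(\<lambda>n. (cmod (u (n + k)))\<^sup>2) summable_on UNIV"
proof -
  have "bij_betw (\<lambda>n. n + k) UNIV (UNIV :: int set)"
    by (rule bij_betw_byWitness[where f' = "\<lambda>n. n - k"]) auto
  from summable_on_reindex_bij_betw[OF this, of "\<lambda>n. (cmod (u n))\<^sup>2"] assms
  show ?thesis by simp
qed

lemma square_summable_prod:
  fixes u v :: "int \<Rightarrow> complex"
  assumes "(\<lambda>n. (cmod (u n))\<^sup>2) summable_on UNIV" "(\<lambda>n. (cmod (v n))\<^sup>2) summable_on UNIV"
  shows "(\<lambda>n. u n * cnj (v n)) summable_on UNIV"
proof (rule abs_summable_summable, rule abs_summable_product)
  show "(\<lambda>n. norm (u n * u n)) summable_on UNIV"
    using assms(1) by (simp add: norm_mult power2_eq_square)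
  show "(\<lambda>n. norm (cnj (v n) * cnj (v n))) summable_on UNIV"
    using assms(2) by (simp add: norm_mult power2_eq_square)
qed

text \<open>The complex inner product, linear in the first argument.\<close>

definition cinner :: "ell2 \<Rightarrow> ell2 \<Rightarrow> complex" where
  "cinner u v = (\<Sum>\<^sub>\<infinity>n. u $$ n * cnj (v $$ n))"

lift_definition scaleC :: "complex \<Rightarrow> ell2 \<Rightarrow> ell2" (infixr "*\<^sub>C" 75) is "\<lambda>c u n. c * u n"
  by (rule square_summable_mult) auto

lemma cinner_summable: "(\<lambda>n. u $$ n * cnj (v $$ n)) summable_on UNIV"
  by (intro square_summable_prod ell2_summable)

text \<open>
  The real inner product is the real part of \<^const>\<open>cinner\<close>, so the resulting norm and topology
  are the usual ones of \<open>\<ell>\<^sup>2(\<int>)\<close>.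
\<close>

instantiation ell2 :: real_inner
begin

lift_definition zero_ell2 :: ell2 is "\<lambda>_. 0" by simp

lift_definition plus_ell2 :: "ell2 \<Rightarrow> ell2 \<Rightarrow> ell2" is "\<lambda>u v n. u n + v n"
  by (simp add: square_summable_add)

lift_definition uminus_ell2 :: "ell2 \<Rightarrow> ell2" is "\<lambda>u n. - u n" by simp

lift_definition minus_ell2 :: "ell2 \<Rightarrow> ell2 \<Rightarrow> ell2" is "\<lambda>u v n. u n - v n"
  using square_summable_add[where v = "\<lambda>n. - v n" for v] by simp

lift_definition scaleR_ell2 :: "real \<Rightarrow> ell2 \<Rightarrow> ell2" is "\<lambda>r u n. r *\<^sub>R u n"
  by (simp add: power_mult_distrib summable_on_cmult_right)

definition inner_ell2 :: "ell2 \<Rightarrow> ell2 \<Rightarrow> real" where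
  "inner_ell2 u v = Re (cinner u v)"

definition norm_ell2 :: "ell2 \<Rightarrow> real" where
  "norm_ell2 u = sqrt (inner u u)"

definition sgn_ell2 :: "ell2 \<Rightarrow> ell2" where
  "sgn_ell2 u = inverse (norm u) *\<^sub>R u"

definition dist_ell2 :: "ell2 \<Rightarrow> ell2 \<Rightarrow> real" where
  "dist_ell2 u v = norm (u - v)"

definition uniformity_ell2 :: "(ell2 \<times> ell2) filter" where
  "uniformity_ell2 = (INF e\<in>{0<..}. principal {(x, y). dist x y < e})"

definition open_ell2 :: "ell2 set \<Rightarrow> bool" where
  "open_ell2 U \<longleftrightarrow> (\<forall>x\<in>U. eventually (\<lambda>(x', y). x' = x \<longrightarrow> y \<in> U) uniformity)"

instance
proof
  fix x y z :: ell2 and a b r :: real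
  show "x + y + z = x + (y + z)" by transfer (simp add: add.assoc)
  show "x + y = y + x" by transfer (simp add: add.commute)
  show "0 + x = x" by transfer simp
  show "- x + x = 0" by transfer simp
  show "x - y = x + - y" by transfer simp
  show "a *\<^sub>R (x + y) = a *\<^sub>R x + a *\<^sub>R y" by transfer (simp add: algebra_simps)
  show "(a + b) *\<^sub>R x = a *\<^sub>R x + b *\<^sub>R x" by transfer (simp add: algebra_simps)
  show "a *\<^sub>R b *\<^sub>R x = (a * b) *\<^sub>R x" by transfer simp
  show "1 *\<^sub>R x = x" by transfer simp
  show "sgn x = inverse (norm x) *\<^sub>R x" by (fact sgn_ell2_def)
  show "dist x y = norm (x - y)" by (fact dist_ell2_def)
  show "uniformity = (INF e\<in>{0<..}. principal {(x, y :: ell2). dist x y < e})"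
    by (fact uniformity_ell2_def)
  show "open U \<longleftrightarrow> (\<forall>x\<in>U. \<forall>\<^sub>F (x', y) in uniformity. x' = x \<longrightarrow> y \<in> U)" for U :: "ell2 set"
    by (fact open_ell2_def)
  show "norm x = sqrt (inner x x)" by (fact norm_ell2_def)
  have "cinner y x = cnj (cinner x y)"
    unfolding cinner_def infsum_cnj[symmetric] by (intro infsum_cong) simp
  then show "inner x y = inner y x"
    by (simp add: inner_ell2_def)
  have "cinner (x + y) z = cinner x z + cinner y z"
    unfolding cinner_def infsum_add[OF cinner_summable cinner_summable, symmetric]
    by (intro infsum_cong) (simp add: plus_ell2.rep_eq algebra_simps)
  then show "inner (x + y) z = inner x z + inner y z"
    by (simp add: inner_ell2_def)
  have "cinner (r *\<^sub>R x) y = complex_of_real r * cinner x y"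
    unfolding cinner_def infsum_cmult_right[OF cinner_summable, symmetric]
    by (intro infsum_cong) (simp add: scaleR_ell2.rep_eq scaleR_conv_of_real mult.assoc)
  then show "inner (r *\<^sub>R x) y = r * inner x y"
    by (simp add: inner_ell2_def)
  have sq: "inner x x = (\<Sum>\<^sub>\<infinity>n. (cmod (x $$ n))\<^sup>2)"
    unfolding inner_ell2_def cinner_def infsum_Re[OF cinner_summable, symmetric]
    by (intro infsum_cong) (simp add: complex_mult_cnj cmod_power2)
  show "0 \<le> inner x x"
    unfolding sq by (intro infsum_nonneg) simp
  show "inner x x = 0 \<longleftrightarrow> x = 0"
  proof
    assume "inner x x = 0"
    then have "(cmod (x $$ n))\<^sup>2 = 0" for n
      using nonneg_infsum_le_0D[OF _ ell2_summable[of x], of n] by (simp add: sq)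
    then show "x = 0"
      by (intro ell2_eqI) (simp add: zero_ell2.rep_eq)
  next
    assume "x = 0"
    then show "inner x x = 0"
      unfolding sq by (simp add: zero_ell2.rep_eq)
  qed
qed

end

lemma norm_ell2_sq: "(norm (u :: ell2))\<^sup>2 = (\<Sum>\<^sub>\<infinity>n. (cmod (u $$ n))\<^sup>2)"
proof -
  have "(norm u)\<^sup>2 = inner u u"
    by (simp add: power2_norm_eq_inner)
  also have "\<dots> = (\<Sum>\<^sub>\<infinity>n. (cmod (u $$ n))\<^sup>2)"
    unfolding inner_ell2_def cinner_def infsum_Re[OF cinner_summable, symmetric]
    by (intro infsum_cong) (simp add: complex_mult_cnj cmod_power2)
  finally show ?thesis .
qed

lemma sum_le_norm_ell2_sq:
  assumes "finite F"
  shows "(\<Sum>n\<in>F. (cmod (u $$ n))\<^sup>2) \<le> (norm u)\<^sup>2"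
  unfolding norm_ell2_sq by (rule finite_sum_le_infsum[OF ell2_summable assms]) auto

lemma cmod_nth_le_norm: "cmod (u $$ n) \<le> norm u"
  using sum_le_norm_ell2_sq[of "{n}" u] by (simp add: power2_le_iff_abs_le)

lemma norm_ell2_leI:
  assumes "0 \<le> B" "\<And>F. finite F \<Longrightarrow> (\<Sum>n\<in>F. (cmod (u $$ n))\<^sup>2) \<le> B\<^sup>2"
  shows "norm u \<le> B"
proof -
  have "(norm u)\<^sup>2 \<le> B\<^sup>2"
    unfolding norm_ell2_sq by (rule infsum_le_finite_sums[OF ell2_summable]) (rule assms(2))
  then show ?thesis
    using assms(1) by (simp add: power2_le_iff_abs_le)
qed

lemma square_summableI:
  fixes u :: "int \<Rightarrow> complex"
  assumes "\<And>F. finite F \<Longrightarrow> (\<Sum>n\<in>F. (cmod (u n))\<^sup>2) \<le> B"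
  shows "(\<lambda>n. (cmod (u n))\<^sup>2) summable_on UNIV"
  by (rule nonneg_bdd_above_summable_on) (use assms in \<open>auto intro!: bdd_aboveI[of _ B]\<close>)

instance ell2 :: banach
proof
  fix X :: "nat \<Rightarrow> ell2"
  assume X: "Cauchy X"
  have "convergent (\<lambda>k. X k $$ n)" for n
    unfolding Cauchy_convergent_iff[symmetric]
  proof (rule CauchyI)
    fix e :: real
    assume "e > 0"
    then obtain M where M: "\<And>k l. k \<ge> M \<Longrightarrow> l \<ge> M \<Longrightarrow> norm (X k - X l) < e"
      using CauchyD[OF X] by blast
    then have "norm (X k $$ n - X l $$ n) < e" if "k \<ge> M" "l \<ge> M" for k l
      using cmod_nth_le_norm[of "X k - X l" n] M[OF that] by (simp add: minus_ell2.rep_eq)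
    then show "\<exists>M. \<forall>k\<ge>M. \<forall>l\<ge>M. norm (X k $$ n - X l $$ n) < e"
      by blast
  qed
  then obtain f where f: "\<And>n. (\<lambda>k. X k $$ n) \<longlonglongrightarrow> f n"
    unfolding convergent_def by metis
  have tail: "\<exists>M. \<forall>k\<ge>M. \<forall>F. finite F \<longrightarrow> (\<Sum>n\<in>F. (cmod (X k $$ n - f n))\<^sup>2) \<le> e\<^sup>2" if e: "e > 0" for e
  proof -
    obtain M where M: "\<And>k l. k \<ge> M \<Longrightarrow> l \<ge> M \<Longrightarrow> norm (X k - X l) < e"
      using CauchyD[OF X e] by blast
    have "(\<Sum>n\<in>F. (cmod (X k $$ n - f n))\<^sup>2) \<le> e\<^sup>2" if k: "k \<ge> M" and F: "finite F" for k F
    proof (rule tendsto_upperbound)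
      show "(\<lambda>l. \<Sum>n\<in>F. (cmod (X k $$ n - X l $$ n))\<^sup>2) \<longlonglongrightarrow> (\<Sum>n\<in>F. (cmod (X k $$ n - f n))\<^sup>2)"
        by (intro tendsto_intros f)
      show "\<forall>\<^sub>F l in sequentially. (\<Sum>n\<in>F. (cmod (X k $$ n - X l $$ n))\<^sup>2) \<le> e\<^sup>2"
        unfolding eventually_sequentially
      proof (intro exI allI impI)
        fix l
        assume l: "M \<le> l"
        have "(\<Sum>n\<in>F. (cmod ((X k - X l) $$ n))\<^sup>2) \<le> (norm (X k - X l))\<^sup>2"
          by (rule sum_le_norm_ell2_sq[OF F])
        also have "\<dots> \<le> e\<^sup>2"
          using M[OF k l] by (intro power_mono) auto
        finally show "(\<Sum>n\<in>F. (cmod (X k $$ n - X l $$ n))\<^sup>2) \<le> e\<^sup>2"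
          by (simp add: minus_ell2.rep_eq)
      qed
    qed simp
    then show ?thesis by blast
  qed
  obtain K where K: "\<And>F. finite F \<Longrightarrow> (\<Sum>n\<in>F. (cmod (X K $$ n - f n))\<^sup>2) \<le> 1\<^sup>2"
    using tail[of 1] by auto
  have "(\<lambda>n. (cmod (X K $$ n - f n))\<^sup>2) summable_on UNIV"
    by (rule square_summableI[OF K])
  then have "(\<lambda>n. (cmod (- (X K $$ n - f n) + X K $$ n))\<^sup>2) summable_on UNIV"
    by (intro square_summable_add ell2_summable) (simp add: norm_minus_commute)
  then have "(\<lambda>n. (cmod (f n))\<^sup>2) summable_on UNIV"
    by simp
  then have L: "Abs_ell2 f $$ n = f n" for n
    by (simp add: Abs_ell2_inverse)
  have "X \<longlonglongrightarrow> Abs_ell2 f"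
  proof (rule LIMSEQ_I)
    fix r :: real
    assume r: "r > 0"
    obtain M where M: "\<And>k F. k \<ge> M \<Longrightarrow> finite F \<Longrightarrow> (\<Sum>n\<in>F. (cmod (X k $$ n - f n))\<^sup>2) \<le> (r / 2)\<^sup>2"
      using tail[of "r / 2"] r by auto
    have "norm (X k - Abs_ell2 f) \<le> r / 2" if "k \<ge> M" for k
      by (rule norm_ell2_leI) (use r M[OF that] in \<open>simp_all add: minus_ell2.rep_eq L\<close>)
    then show "\<exists>M. \<forall>k\<ge>M. norm (X k - Abs_ell2 f) < r"
      using r by (intro exI[of _ M]) fastforce
  qed
  then show "convergent X"
    by (rule convergentI)
qed

lift_definition delta :: "int \<Rightarrow> ell2" is "\<lambda>m n. if n = m then 1 else 0"
proof -
  fix m :: int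
  have "(\<lambda>n. (cmod (if n = m then 1 else 0))\<^sup>2) summable_on UNIV"
    by (rule finite_nonzero_values_imp_summable_on) (auto intro: finite_subset[of _ "{m}"])
  then show "(\<lambda>n. (cmod (if n = m then 1 else 0))\<^sup>2) summable_on UNIV" .
qed

lemma cinner_delta: "cinner u (delta m) = u $$ m"
proof -
  have "cinner u (delta m) = (\<Sum>\<^sub>\<infinity>n\<in>{m}. u $$ n)"
    unfolding cinner_def by (rule infsum_cong_neutral) (auto simp: delta.rep_eq)
  then show ?thesis by simp
qed


section \<open>The Fibonacci Hamiltonian\<close>

definition phi :: real where
  "phi = (sqrt 5 + 1) / 2"

definition fib_potential :: "real \<Rightarrow> int \<Rightarrow> real" where
  "fib_potential l n = l * indicator {1 - inverse phi ..< 1} (frac (of_int n * inverse phi))"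

lemma fib_potential_bound: "\<bar>fib_potential l n\<bar> \<le> \<bar>l\<bar>"
  by (simp add: fib_potential_def indicator_def)

lift_definition fib_hamiltonian :: "real \<Rightarrow> ell2 \<Rightarrow> ell2" is
  "\<lambda>l u n. u (n + 1) + u (n - 1) + of_real (fib_potential l n) * u n"
proof -
  fix l :: real and u :: "int \<Rightarrow> complex"
  assume u: "(\<lambda>n. (cmod (u n))\<^sup>2) summable_on UNIV"
  have "(\<lambda>n. (cmod (u (n - 1)))\<^sup>2) summable_on UNIV"
    using square_summable_shift[OF u, of "-1"] by simp
  moreover have "(\<lambda>n. (cmod (of_real (fib_potential l n) * u n))\<^sup>2) summable_on UNIV"
    by (rule square_summable_mult[OF u, where B = "\<bar>l\<bar>"]) (simp add: fib_potential_bound)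
  ultimately show "(\<lambda>n. (cmod (u (n + 1) + u (n - 1)
      + of_real (fib_potential l n) * u n))\<^sup>2) summable_on UNIV"
    using square_summable_shift[OF u, of 1] by (simp add: square_summable_add)
qed

lemma norm_ell2_le_of_pointwise:
  assumes "0 \<le> B" "bij \<sigma>" "\<And>n. cmod (v $$ n) \<le> B * cmod (u $$ \<sigma> n)"
  shows "norm v \<le> B * norm u"
proof (rule norm_ell2_leI)
  fix F :: "int set"
  assume F: "finite F"
  have inj: "inj_on \<sigma> F"
    using assms(2) by (meson bij_is_inj inj_on_subset subset_UNIV)
  have "(\<Sum>n\<in>F. (cmod (v $$ n))\<^sup>2) \<le> (\<Sum>n\<in>F. B\<^sup>2 * (cmod (u $$ \<sigma> n))\<^sup>2)"
    using assms(3) by (intro sum_mono) (metis norm_ge_zero power_mono power_mult_distrib)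
  also have "\<dots> = B\<^sup>2 * (\<Sum>n\<in>\<sigma> ` F. (cmod (u $$ n))\<^sup>2)"
    by (simp add: sum_distrib_left sum.reindex[OF inj])
  also have "\<dots> \<le> B\<^sup>2 * (norm u)\<^sup>2"
    using F by (intro mult_left_mono sum_le_norm_ell2_sq) auto
  finally show "(\<Sum>n\<in>F. (cmod (v $$ n))\<^sup>2) \<le> (B * norm u)\<^sup>2"
    by (simp add: power_mult_distrib)
qed (use assms(1) in simp)

lemma bounded_linear_scaleC: "bounded_linear (\<lambda>u. c *\<^sub>C u)"
proof (rule bounded_linear_intro[where K = "cmod c"])
  show "c *\<^sub>C (u + v) = c *\<^sub>C u + c *\<^sub>C v" for u v
    by transfer (simp add: algebra_simps)
  show "c *\<^sub>C (r *\<^sub>R u) = r *\<^sub>R (c *\<^sub>C u)" for r u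
    by transfer simp
  show "norm (c *\<^sub>C u) \<le> norm u * cmod c" for u
    using norm_ell2_le_of_pointwise[of "cmod c" id "c *\<^sub>C u" u]
    by (simp add: scaleC.rep_eq norm_mult mult.commute)
qed

lemma bounded_linear_fib_hamiltonian: "bounded_linear (fib_hamiltonian l)"
proof (rule bounded_linear_intro[where K = "2 + \<bar>l\<bar>"])
  show "fib_hamiltonian l (u + v) = fib_hamiltonian l u + fib_hamiltonian l v" for u v
    by transfer (simp add: algebra_simps)
  show "fib_hamiltonian l (r *\<^sub>R u) = r *\<^sub>R fib_hamiltonian l u" for r u
    by transfer (simp add: algebra_simps)
  fix u
  define a where "a = Abs_ell2 (\<lambda>n. u $$ (n + 1))"
  define b where "b = Abs_ell2 (\<lambda>n. u $$ (n - 1))"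
  define c where "c = Abs_ell2 (\<lambda>n. of_real (fib_potential l n) * u $$ n)"
  have a: "a $$ n = u $$ (n + 1)" for n
    using square_summable_shift[OF ell2_summable, of u 1] by (simp add: a_def Abs_ell2_inverse)
  have b: "b $$ n = u $$ (n - 1)" for n
    using square_summable_shift[OF ell2_summable, of u "-1"] by (simp add: b_def Abs_ell2_inverse)
  have c: "c $$ n = of_real (fib_potential l n) * u $$ n" for n
    using square_summable_mult[OF ell2_summable[of u], of "\<lambda>n. of_real (fib_potential l n)" "\<bar>l\<bar>"]
    by (simp add: c_def Abs_ell2_inverse fib_potential_bound)
  have "bij (\<lambda>n :: int. n + 1)" "bij (\<lambda>n :: int. n - 1)"
    by (rule o_bij[where g = "\<lambda>n. n - 1"] o_bij[where g = "\<lambda>n. n + 1"]; auto)+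
  then have "norm a \<le> 1 * norm u \<and> norm b \<le> 1 * norm u"
    by (intro conjI norm_ell2_le_of_pointwise[where \<sigma> = "\<lambda>n. n + 1"]
          norm_ell2_le_of_pointwise[where \<sigma> = "\<lambda>n. n - 1" and v = b]) (simp_all add: a b)
  moreover have "norm c \<le> \<bar>l\<bar> * norm u"
    by (rule norm_ell2_le_of_pointwise[of _ id])
      (auto simp: c norm_mult fib_potential_bound mult_right_mono)
  moreover have "fib_hamiltonian l u = a + b + c"
    by (rule ell2_eqI) (simp add: fib_hamiltonian.rep_eq plus_ell2.rep_eq a b c)
  moreover have "norm (a + b + c) \<le> norm a + norm b + norm c"
    by (meson norm_triangle_mono norm_triangle_ineq order_refl)
  ultimately show "norm (fib_hamiltonian l u) \<le> norm u * (2 + \<bar>l\<bar>)"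
    by (simp add: algebra_simps)
qed


section \<open>Quantum dynamics\<close>

text \<open>
  The exponential of a bounded operator, as a series converging in the norm of \<open>\<ell>\<^sup>2(\<int>)\<close>
  (see \<open>op_exp_summable\<close>).
\<close>

definition op_exp :: "(ell2 \<Rightarrow> ell2) \<Rightarrow> ell2 \<Rightarrow> ell2" where
  "op_exp A u = (\<Sum>k. (1 / fact k) *\<^sub>R (A ^^ k) u)"

lemma op_exp_summable:
  fixes A :: "ell2 \<Rightarrow> ell2"
  assumes "bounded_linear A"
  shows "summable (\<lambda>k. (1 / fact k) *\<^sub>R (A ^^ k) u)"
proof -
  obtain C where C: "0 \<le> C" "\<And>v. norm (A v) \<le> norm v * C"
    using bounded_linear.nonneg_bounded[OF assms] by blast
  have pow: "norm ((A ^^ k) u) \<le> C ^ k * norm u" for k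
  proof (induction k)
    case (Suc k)
    have "norm ((A ^^ Suc k) u) \<le> norm ((A ^^ k) u) * C"
      using C(2)[of "(A ^^ k) u"] by simp
    also have "\<dots> \<le> (C ^ k * norm u) * C"
      by (rule mult_right_mono[OF Suc C(1)])
    finally show ?case by (simp add: mult_ac)
  qed simp
  have le: "norm ((1 / fact k) *\<^sub>R (A ^^ k) u) \<le> (C ^ k /\<^sub>R fact k) * norm u" for k
    using pow[of k] by (simp add: divide_simps mult_ac)
  have "summable (\<lambda>k. (C ^ k /\<^sub>R fact k) * norm u)"
    by (intro summable_mult2 summable_exp_generic)
  then show ?thesis
    by (rule summable_comparison_test'[where N = 0]) (rule le)
qed

text \<open>\<open>evolution H t\<close> is \<open>e\<^sup>-\<^sup>i\<^sup>t\<^sup>H\<close>; it is used for bounded \<open>H\<close> only.\<close>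

definition evolution :: "(ell2 \<Rightarrow> ell2) \<Rightarrow> real \<Rightarrow> ell2 \<Rightarrow> ell2" where
  "evolution H t = op_exp (\<lambda>u. (- \<i> * of_real t) *\<^sub>C H u)"

lemma evolution_summable:
  fixes H :: "ell2 \<Rightarrow> ell2"
  assumes "bounded_linear H"
  shows "summable (\<lambda>k. (1 / fact k) *\<^sub>R ((\<lambda>u. (- \<i> * of_real t) *\<^sub>C H u) ^^ k) u)"
  using op_exp_summable[OF bounded_linear_compose[OF bounded_linear_scaleC assms]] .

text \<open>
  In the following definitions the initial state is \<open>u\<close>. The sum in \<open>moment\<close> and the integral in
  \<open>time_average\<close> are the real-valued ones; for a bounded nearest-neighbour \<open>H\<close> and \<open>u = delta 0\<close>
  both converge, because \<open>cinner (evolution H t u) (delta n)\<close> decays faster than exponentially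
  in \<open>\<bar>n\<bar>\<close> beyond the ballistic range \<open>\<bar>n\<bar> = O(t)\<close>, so the moments grow at most like \<open>t powr p\<close>.
\<close>

definition moment :: "(ell2 \<Rightarrow> ell2) \<Rightarrow> ell2 \<Rightarrow> real \<Rightarrow> real \<Rightarrow> real" where
  "moment H u p t =
     (\<Sum>\<^sub>\<infinity>n. (real_of_int \<bar>n\<bar> powr p) * (cmod (cinner (evolution H t u) (delta n)))\<^sup>2)"

definition time_average :: "(real \<Rightarrow> real) \<Rightarrow> real \<Rightarrow> real" where
  "time_average f T = 2 / T * (LINT t:{0<..}|lborel. exp (- 2 * t / T) * f t)"

definition lower_transport_exponent :: "(ell2 \<Rightarrow> ell2) \<Rightarrow> ell2 \<Rightarrow> real \<Rightarrow> ereal" where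
  "lower_transport_exponent H u p =
     Liminf at_top (\<lambda>T. ereal (ln (time_average (moment H u p) T) / (p * ln T)))"

definition S_u :: "real \<Rightarrow> real" where
  "S_u l = 2 * l + 22"

end

theory Submission
  imports Defs "HOL-Number_Theory.Fib"
begin

text \<open>
  Restricting the identity \<open>(H - z)\<^sup>-\<^sup>1\<delta>\<^sub>0 = \<i> \<integral> e\<^sup>i\<^sup>z\<^sup>t e\<^sup>-\<^sup>i\<^sup>t\<^sup>H \<delta>\<^sub>0 dt\<close> to a single energy \<open>z = E + \<i>\<epsilon>\<close>,
  Cauchy--Schwarz bounds the averaged moment at time \<open>2/\<epsilon>\<close> from below by
  \<open>\<epsilon>\<^sup>2 \<Sum>\<^sub>n \<bar>n\<bar>\<^sup>p \<bar>(H - z)\<^sup>-\<^sup>1\<delta>\<^sub>0(n)\<bar>\<^sup>2\<close>, so it suffices to choose one good energy.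
  Nested intervals give a real \<open>E\<close> at which every second trace in the trace map is bounded by 2, and
  along this orbit two steps of the trace map expand errors by less than \<open>S_u l\<close>; hence for
  \<open>\<epsilon> \<approx> S_u l\<^sup>-\<^sup>J\<close> the first \<open>J\<close> of these traces stay below \<open>2 + 1/12\<close> at \<open>z\<close>. The two-block (Gordon)
  argument on prefix squares of the Fibonacci word then forces the mass of every solution to grow
  geometrically, and puts a definite part of it at distance at least \<open>\<phi>\<^sup>2\<^sup>J\<close> from the origin.
\<close>

section \<open>The potential as a rotation coding\<close>

text \<open>The term \<open>-2/p\<close> of the bound is the price of the single-energy estimate: it
  carries a factor \<epsilon>^2, and \<epsilon> = 2/T.

  Only every second trace is kept bounded because neighbouring ones cannot be. Three consecutive
  traces satisfy an invariant with value \<open>4 + l^2\<close>; for \<open>l > 4\<close> it forces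
  a trace \<open>b\<close> between two traces \<open>a\<close>, \<open>c\<close> of modulus at most
  2 to have modulus between \<open>l - 2 > 2\<close> and \<open>l + 2\<close>. This size of
  \<open>b\<close> is what lets the intervals be nested. It also endangers the error bound: the
  derivative \<open>2 * b * c - a\<close> of the double step could be of order \<open>4 * l\<close>.
  But the next bounded trace is \<open>b * (c^2 - 1) - a * c\<close>, which limits the modulus of
  \<open>b * c\<close> to that of \<open>b\<close> plus 3; hence the leading term
  \<open>2 * l\<close> of \<open>S_u l\<close>.

  In space the obstacle is the source at site 0, across which the resolvent is not a solution. It is
  one on each half-line, and the symmetry \<open>n -> - n - 1\<close> of the potential away from the
  origin lets one argument serve both sides.\<close>

abbreviation inv_phi :: real ("\<alpha>") where "\<alpha> \<equiv> inverse phi"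

lemma phi_pos: "phi > 1"
  unfolding phi_def using real_sqrt_gt_1_iff[of 5] by simp

lemma phi_sq: "phi * phi = phi + 1"
  unfolding phi_def by (simp add: field_simps)

lemma alpha_eq: "\<alpha> = phi - 1"
  using phi_sq phi_pos by (simp add: field_simps)

lemma alpha_bounds: "0 < \<alpha>" "\<alpha> < 1"
  using phi_pos by (auto simp: field_simps)

lemma alpha_sq: "\<alpha> * \<alpha> = 1 - \<alpha>"
  using phi_sq unfolding alpha_eq by (simp add: algebra_simps)

section \<open>Convergents of \<alpha> and the quality of rational approximation\<close>

text \<open>The signed error of the convergent \<open>fib k / fib (Suc k)\<close>, by the recurrence
  and \<open>\<alpha>^2 = 1 - \<alpha>\<close>; the alternating sign tells on which side it
  lies.\<close>

lemma fib_alpha: "real (fib (Suc k)) * \<alpha> - real (fib k) = (-1) ^ k * \<alpha> ^ Suc k"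
proof (induction k rule: fib.induct)
  case 2
  show ?case using alpha_sq by simp
next
  case (3 n)
  have "real (fib (Suc (Suc (Suc n)))) * \<alpha> - real (fib (Suc (Suc n)))
      = (-1) ^ Suc n * \<alpha> ^ Suc (Suc n) + (-1) ^ n * \<alpha> ^ Suc n"
    using 3 by (simp add: algebra_simps)
  also have "\<dots> = (-1) ^ n * \<alpha> ^ Suc n * (1 - \<alpha>)"
    by (simp add: algebra_simps)
  also have "\<dots> = (-1) ^ Suc (Suc n) * \<alpha> ^ Suc (Suc (Suc n))"
    unfolding alpha_sq[symmetric] by simp
  finally show ?case .
qed simp

lemma phi_power_le_fib: "phi ^ n \<le> real (fib (Suc (Suc n)))"
proof (induction n rule: fib.induct)
  case 2
  have "sqrt 5 \<le> sqrt 9" by (intro real_sqrt_le_mono) simp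
  then show ?case by (simp add: phi_def)
next
  case (3 n)
  have "phi ^ Suc (Suc n) = phi ^ n * (phi * phi)"
    by (simp add: mult_ac)
  then have "phi ^ Suc (Suc n) = phi ^ Suc n + phi ^ n"
    unfolding phi_sq by (simp add: algebra_simps)
  then show ?case using 3 by simp
qed simp

text \<open>
  In the basis formed by two consecutive convergents \<open>(fib (k + 1), fib k)\<close>, \<open>(fib (k + 2), fib (k + 1))\<close>
  of \<open>\<int>\<^sup>2\<close>, an integer approximating \<open>n\<alpha>\<close> this well from the given side has coordinates that
  force \<open>n \<le> 0\<close> or \<open>n \<ge> fib (k + 2)\<close>.
\<close>

lemma no_better_approximation:
  fixes n :: nat and M :: int
  assumes n: "1 \<le> n" "n < fib (k + 2)"
    and M: "0 \<le> (-1) ^ k * (of_int M - n * \<alpha>)" "(-1) ^ k * (of_int M - n * \<alpha>) \<le> \<alpha> ^ Suc k"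
  shows False
proof -
  define f0 f1 f2 :: int where "f0 = fib k" and "f1 = fib (Suc k)" and "f2 = fib (Suc (Suc k))"
  define d :: int where "d = (-1) ^ k"
  have dd: "d * d = 1" by (simp add: d_def power_mult_distrib[symmetric])
  have f: "f0 \<ge> 0" "f1 > 0" "f2 > 0"
    using fib_neq_0_nat[of "Suc k"] fib_neq_0_nat[of "Suc (Suc k)"]
    by (simp_all add: f0_def f1_def f2_def del: fib.simps)
  have cas: "f2 * f0 - f1 * f1 = - d"
    using fib_Cassini_int[of k] by (simp add: f0_def f1_def f2_def d_def power2_eq_square)
  \<comment> \<open>Cramer's rule in the basis of the two convergents: by Cassini's identity the
    determinant is \<open>d\<close>, a unit, so both coordinates are integers.\<close>
  define a b where "a = d * (f1 * n - f2 * M)" and "b = d * (f1 * M - f0 * n)"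
  have ab: "int n = a * f1 + b * f2" "M = a * f0 + b * f1"
  proof -
    have "a * f1 + b * f2 = d * (f1 * f1 - f2 * f0) * n" by (simp add: a_def b_def algebra_simps)
    also have "f1 * f1 - f2 * f0 = d" using cas by simp
    finally show "int n = a * f1 + b * f2" using dd by simp
    have "a * f0 + b * f1 = d * (f1 * f1 - f2 * f0) * M" by (simp add: a_def b_def algebra_simps)
    also have "f1 * f1 - f2 * f0 = d" using cas by simp
    finally show "M = a * f0 + b * f1" using dd by simp
  qed
  have e1: "real_of_int f1 * \<alpha> - f0 = d * \<alpha> ^ Suc k"
    using fib_alpha[of k] by (simp add: f0_def f1_def d_def)
  have e2: "real_of_int f2 * \<alpha> - f1 = - d * \<alpha> ^ Suc k * \<alpha>"
    using fib_alpha[of "Suc k"] by (simp add: f1_def f2_def d_def mult_ac)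
  have dd': "real_of_int d * real_of_int d = 1" using dd by (metis of_int_1 of_int_mult)
  have "of_int M - real n * \<alpha> = a * (f0 - f1 * \<alpha>) + b * (f1 - f2 * \<alpha>)"
    using ab(2) arg_cong[OF ab(1), of real_of_int] by (simp add: algebra_simps)
  also have "\<dots> = d * \<alpha> ^ Suc k * (b * \<alpha> - a)"
    using arg_cong[OF e1, of "\<lambda>x. a * x"] arg_cong[OF e2, of "\<lambda>x. b * x"]
    by (simp add: algebra_simps)
  finally have "real_of_int d * (of_int M - real n * \<alpha>) = (real_of_int d * real_of_int d) * (\<alpha> ^ Suc k * (b * \<alpha> - a))"
    by (simp add: mult_ac)
  then have eq: "(-1) ^ k * (of_int M - real n * \<alpha>) = \<alpha> ^ Suc k * (b * \<alpha> - a)"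
    unfolding dd' by (simp add: d_def)
  have pos: "\<alpha> ^ Suc k > 0" using alpha_bounds by simp
  have lo: "0 \<le> b * \<alpha> - a"
    using M(1) pos unfolding eq by (simp add: zero_le_mult_iff del: power_Suc)
  have "\<alpha> ^ Suc k * (b * \<alpha> - a) \<le> \<alpha> ^ Suc k * 1"
    using M(2) unfolding eq by simp
  then have hi: "b * \<alpha> - a \<le> 1"
    using pos by (simp add: mult_le_cancel_left_pos del: power_Suc)
  have n': "0 < a * f1 + b * f2" "a * f1 + b * f2 < f2"
    using n unfolding ab(1)[symmetric] by (simp_all add: f2_def)
  \<comment> \<open>Given \<open>0 \<le> b * \<alpha> - a \<le> 1\<close>, the sign of
    \<open>b\<close> decides: \<open>b \<ge> 1\<close> forces \<open>a \<ge> 0\<close> and hence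
    \<open>n \<ge> f2\<close>, while \<open>b \<le> 0\<close> forces \<open>a \<le> 0\<close> and
    hence \<open>n \<le> 0\<close>.\<close>
  consider "b = 0" | "b \<ge> 1" | "b \<le> -1" by linarith
  then show False
  proof cases
    case 1
    then have "a \<le> 0" using lo by simp
    then have "a * f1 \<le> 0" using f by (simp add: mult_nonpos_nonneg)
    then show False using n' 1 by simp
  next
    case 2
    then have "1 * \<alpha> \<le> b * \<alpha>" using alpha_bounds by (intro mult_right_mono) auto
    then have "real_of_int a > -1" using hi alpha_bounds by linarith
    then have "a \<ge> 0" by linarith
    then have "a * f1 \<ge> 0" "b * f2 \<ge> 1 * f2" using f 2 by (auto intro: mult_right_mono)
    then show False using n' by linarith
  next
    case 3
    then have "b * \<alpha> \<le> (-1) * \<alpha>" using alpha_bounds by (intro mult_right_mono) auto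
    then have "real_of_int a < 0" using lo alpha_bounds by linarith
    then have "a < 0" by linarith
    then have "a * f1 \<le> 0" "b * f2 \<le> 0" using f 3 by (auto simp: mult_nonpos_nonneg)
    then show False using n' by linarith
  qed
qed

lemma ex_fib_gt: "\<exists>k. n < fib (k + 2)"
proof
  have "n < fib (n + 2)" if "n \<ge> 0" for n
  proof (induction n)
    case (Suc n)
    have "fib (Suc n) > 0" by (simp add: fib_neq_0_nat)
    then show ?case using Suc by simp
  qed simp
  then show "n < fib (n + 2)" by simp
qed

text \<open>An integer value would be an approximation with error 0, excluded at any scale
  \<open>k\<close> with \<open>n < fib (k + 2)\<close>.\<close>

lemma alpha_mult_not_int:
  assumes "1 \<le> (n :: nat)"
  shows "real n * \<alpha> \<noteq> of_int M"
proof
  assume eq: "real n * \<alpha> = of_int M"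
  obtain k where "n < fib (k + 2)" using ex_fib_gt by blast
  then show False
    using no_better_approximation[of n k M] assms eq alpha_bounds by simp
qed

text \<open>Adding \<open>fib (Suc k)\<close> moves \<open>n * \<alpha>\<close> by the integer
  \<open>fib k\<close> plus the convergent error. The floor could react to that error only if an
  integer lay within it on the corresponding side of \<open>n * \<alpha>\<close>, a forbidden
  approximation.\<close>

lemma floor_fib_shift:
  fixes n :: nat
  assumes "1 \<le> n" "n < fib (k + 2)"
  shows "\<lfloor>real (n + fib (Suc k)) * \<alpha>\<rfloor> = \<lfloor>real n * \<alpha>\<rfloor> + int (fib k)"
proof -
  define y where "y = real n * \<alpha>"
  have pos: "\<alpha> ^ Suc k > 0" using alpha_bounds by simp
  have "\<lfloor>y + (-1) ^ k * \<alpha> ^ Suc k\<rfloor> = \<lfloor>y\<rfloor>"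
  proof (cases "even k")
    case True
    have "\<not> (of_int (\<lfloor>y\<rfloor> + 1) \<le> y + \<alpha> ^ Suc k)"
    proof
      assume "of_int (\<lfloor>y\<rfloor> + 1) \<le> y + \<alpha> ^ Suc k"
      moreover have "y \<le> of_int (\<lfloor>y\<rfloor> + 1)" by linarith
      ultimately show False
        using no_better_approximation[OF assms, of "\<lfloor>y\<rfloor> + 1"] True
        unfolding y_def[symmetric] by (simp del: power_Suc add: algebra_simps)
    qed
    then show ?thesis
      using pos True by (intro floor_unique) (simp_all del: power_Suc, linarith+)
  next
    case False
    have "\<not> (y - \<alpha> ^ Suc k < of_int \<lfloor>y\<rfloor>)"
    proof
      assume "y - \<alpha> ^ Suc k < of_int \<lfloor>y\<rfloor>"
      moreover have "of_int \<lfloor>y\<rfloor> \<le> y" by linarith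
      ultimately show False
        using no_better_approximation[OF assms, of "\<lfloor>y\<rfloor>"] False
        unfolding y_def[symmetric] by (simp del: power_Suc add: algebra_simps)
    qed
    then show ?thesis
      using pos False by (intro floor_unique) (simp_all del: power_Suc, linarith+)
  qed
  moreover have "real (n + fib (Suc k)) * \<alpha> = (y + (-1) ^ k * \<alpha> ^ Suc k) + of_int (int (fib k))"
    using fib_alpha[of k] by (simp add: y_def algebra_simps)
  ultimately show ?thesis
    by (simp only: floor_add_int[symmetric] y_def)
qed

section \<open>Repetitions and reflection symmetry of the potential\<close>

text \<open>The Sturmian form of the coding: a rotation by \<alpha> passes an integer exactly when
  the fractional part lies in the last interval of length \<alpha>.\<close>

lemma fib_potential_floor:
  "fib_potential l n = l * of_int (\<lfloor>of_int (n + 1) * \<alpha>\<rfloor> - \<lfloor>of_int n * \<alpha>\<rfloor>)"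
proof -
  define y where "y = of_int n * \<alpha>"
  have y1: "of_int (n + 1) * \<alpha> = y + \<alpha>" by (simp add: y_def algebra_simps)
  have fr: "0 \<le> frac y" "frac y < 1" by (simp_all add: frac_lt_1)
  show ?thesis
  proof (cases "1 - \<alpha> \<le> frac y")
    case True
    have "\<lfloor>y + \<alpha>\<rfloor> = \<lfloor>y\<rfloor> + 1"
      using True fr alpha_bounds by (intro floor_unique) (auto simp: frac_def)
    then show ?thesis
      using True fr unfolding fib_potential_def y1 y_def[symmetric] by simp
  next
    case False
    have "\<lfloor>y + \<alpha>\<rfloor> = \<lfloor>y\<rfloor>"
      using False fr alpha_bounds(1) unfolding frac_def by (intro floor_unique) linarith+
    then show ?thesis
      using False unfolding fib_potential_def y1 y_def[symmetric] by simp
  qed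
qed

text \<open>Floors at both \<open>n\<close> and \<open>n + 1\<close> enter, so the range is one
  shorter than in \<open>floor_fib_shift\<close>. Once \<open>fib k \<ge> 2\<close> it still covers
  a full period: the potential begins with a square.\<close>

lemma fib_potential_period:
  fixes n :: nat
  assumes "1 \<le> n" "n + 1 < fib (k + 2)"
  shows "fib_potential l (int (n + fib (Suc k))) = fib_potential l (int n)"
  unfolding fib_potential_floor
  using floor_fib_shift[of n k] floor_fib_shift[of "n + 1" k] assms
  by (simp add: add_ac)

text \<open>For non-integers the floor of \<open>- x\<close> is \<open>-1\<close> minus the floor of
  \<open>x\<close>. At \<open>n = 0\<close> the product is an integer, hence the assumption
  \<open>1 \<le> n\<close>.\<close>

lemma fib_potential_reflect:
  fixes n :: nat
  assumes "1 \<le> n"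
  shows "fib_potential l (- int n - 1) = fib_potential l (int n)"
proof -
  have neg: "\<lfloor>- (real m * \<alpha>)\<rfloor> = - \<lfloor>real m * \<alpha>\<rfloor> - 1" if "1 \<le> m" for m
  proof (rule floor_unique)
    show "of_int (- \<lfloor>real m * \<alpha>\<rfloor> - 1) \<le> - (real m * \<alpha>)"
      by (simp, linarith)
    have "of_int \<lfloor>real m * \<alpha>\<rfloor> < real m * \<alpha>"
      using alpha_mult_not_int[OF that, of "\<lfloor>real m * \<alpha>\<rfloor>"] of_int_floor_le[of "real m * \<alpha>"] by linarith
    then show "- (real m * \<alpha>) < of_int (- \<lfloor>real m * \<alpha>\<rfloor> - 1) + 1" by simp
  qed
  have "real_of_int (- int n - 1) * \<alpha> = - (real (Suc n) * \<alpha>)" "real_of_int (- int n - 1 + 1) * \<alpha> = - (real n * \<alpha>)"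
    "real_of_int (int n + 1) * \<alpha> = real (Suc n) * \<alpha>"
    by (simp_all add: algebra_simps)
  then show ?thesis
    unfolding fib_potential_floor using neg[of n] neg[of "Suc n"] assms
    by (simp only: of_nat_Suc) (simp add: algebra_simps)
qed

lemma fib_potential_0: "fib_potential l 0 = 0"
  using alpha_bounds by (simp add: fib_potential_def)

lemma fib_potential_1: "fib_potential l 1 = l"
proof -
  have p: "0 < \<alpha> ^ 3" "\<alpha> ^ 3 < 1" using alpha_bounds by (auto simp: power_less_one_iff)
  have 2: "2 * \<alpha> - 1 = \<alpha> ^ 3" using fib_alpha[of 2] by (simp add: eval_nat_numeral)
  have "\<lfloor>2 * \<alpha>\<rfloor> = 1"
    using p 2 by (intro floor_unique) linarith+
  moreover have "\<lfloor>\<alpha>\<rfloor> = 0" using alpha_bounds by (intro floor_unique) auto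
  ultimately show ?thesis by (simp add: fib_potential_floor)
qed

lemma fib_potential_2: "fib_potential l 2 = 0"
proof -
  have p: "0 < \<alpha> ^ 3" "\<alpha> ^ 3 < 1" using alpha_bounds by (auto simp: power_less_one_iff)
  have 2: "2 * \<alpha> - 1 = \<alpha> ^ 3" using fib_alpha[of 2] by (simp add: eval_nat_numeral)
  have "\<lfloor>2 * \<alpha>\<rfloor> = 1" using p 2 by (intro floor_unique) linarith+
  moreover have "3 * \<alpha> - 2 = - (\<alpha> ^ 4)" using fib_alpha[of 3] by (simp add: eval_nat_numeral)
  moreover have "\<alpha> ^ 4 > 0" using alpha_bounds(1) by (rule zero_less_power)
  ultimately have "\<lfloor>3 * \<alpha>\<rfloor> = 1" using p 2 by (intro floor_unique) linarith+
  with \<open>\<lfloor>2 * \<alpha>\<rfloor> = 1\<close> show ?thesis by (simp add: fib_potential_floor)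
qed

section \<open>The trace map\<close>

text \<open>For \<open>n \<ge> 1\<close> this is the trace of \<open>word_matrix l z n\<close>; the
  initial 2 is the trace of the identity. The type is polymorphic so that real energies and their
  complex perturbations share one recursion.\<close>

fun fib_trace :: "'a::comm_ring_1 \<Rightarrow> 'a \<Rightarrow> nat \<Rightarrow> 'a" where
  "fib_trace l z 0 = 2"
| "fib_trace l z (Suc 0) = z"
| "fib_trace l z (Suc (Suc 0)) = z - l"
| "fib_trace l z (Suc (Suc (Suc n))) =
     fib_trace l z (Suc (Suc n)) * fib_trace l z (Suc n) - fib_trace l z n"

lemma continuous_on_fib_trace: "continuous_on A (\<lambda>E. fib_trace (l :: real) E n)"
proof (induction n rule: less_induct)
  case (less n)
  show ?case
  proof (cases "n < 3")
    case True
    then consider "n = 0" | "n = Suc 0" | "n = Suc (Suc 0)" by linarith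
    then show ?thesis by cases (auto intro!: continuous_intros)
  next
    case False
    then obtain m where "n = Suc (Suc (Suc m))" by (auto dest!: not_less_iff_gr_or_eq[THEN iffD1] less_imp_Suc_add simp: eval_nat_numeral)
    then show ?thesis using less by (auto intro!: continuous_intros)
  qed
qed

text \<open>The Fricke-Vogt invariant. As a quadratic in \<open>w\<close> it is unchanged under the
  exchange \<open>w -> x * y - w\<close> of its roots, which is the step of the trace map.\<close>

lemma fib_trace_invariant:
  fixes l z :: "'a::comm_ring_1"
  defines "X \<equiv> fib_trace l z"
  shows "(X (n + 2))\<^sup>2 + (X (n + 1))\<^sup>2 + (X n)\<^sup>2 - X (n + 2) * X (n + 1) * X n = 4 + l\<^sup>2"
proof (induction n)
  case 0
  show ?case by (simp add: X_def power2_eq_square algebra_simps numeral_2_eq_2)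
next
  case (Suc n)
  have "X (Suc n + 2) = X (n + 2) * X (n + 1) - X n" by (simp add: X_def)
  moreover have "Suc n + 1 = n + 2" by simp
  moreover have "(x * y - w)\<^sup>2 + x\<^sup>2 + y\<^sup>2 - (x * y - w) * x * y = x\<^sup>2 + y\<^sup>2 + w\<^sup>2 - x * y * w" for x y w :: 'a
    by (simp add: power2_eq_square algebra_simps)
  ultimately show ?case using Suc by (simp only: Suc_eq_plus1)
qed

lemma fib_trace_step2:
  "fib_trace l z (n + 4) =
    fib_trace l z (n + 1) * ((fib_trace l z (n + 2))\<^sup>2 - 1) - fib_trace l z n * fib_trace l z (n + 2)"
  by (simp add: eval_nat_numeral algebra_simps)

text \<open>The invariant solved for the middle trace:
  \<open>(2 * b - a * c)^2 = (4 - a^2) * (4 - c^2) + 4 * l^2\<close>, where the product is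
  nonnegative.\<close>

lemma middle_trace_bounds:
  fixes a b c l :: real
  assumes inv: "c\<^sup>2 + b\<^sup>2 + a\<^sup>2 - c * b * a = 4 + l\<^sup>2"
    and ac: "\<bar>a\<bar> \<le> 2" "\<bar>c\<bar> \<le> 2" and l: "l \<ge> 0"
  shows "l - 2 \<le> \<bar>b\<bar>" "\<bar>b\<bar> \<le> l + 2"
proof -
  define A where "A = \<bar>a * c\<bar>"
  have A: "0 \<le> A" "A \<le> 4"
    using mult_mono[OF ac] by (auto simp: A_def abs_mult)
  have sq: "(2 * b - a * c)\<^sup>2 = (4 - a\<^sup>2) * (4 - c\<^sup>2) + 4 * l\<^sup>2"
    using inv by (simp add: power2_eq_square algebra_simps)
  have a4: "a\<^sup>2 \<le> 4" "c\<^sup>2 \<le> 4"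
    using power_mono[OF ac(1), of 2] power_mono[OF ac(2), of 2] by auto
  have "0 \<le> (4 - a\<^sup>2) * (4 - c\<^sup>2)" using a4 by simp
  then have "(2 * l)\<^sup>2 \<le> \<bar>2 * b - a * c\<bar>\<^sup>2" using sq by (simp add: power_mult_distrib)
  then have "2 * l \<le> \<bar>2 * b - a * c\<bar>" by (rule power2_le_imp_le) simp
  also have "\<dots> \<le> 2 * \<bar>b\<bar> + A" unfolding A_def by linarith
  finally show "l - 2 \<le> \<bar>b\<bar>" using A by linarith
  \<comment> \<open>By AM-GM the product is at most \<open>(4 - A)^2\<close>; in the final triangle
    inequality \<open>A\<close> then cancels and leaves exactly \<open>l + 2\<close>.\<close>
  have "(\<bar>a\<bar> - \<bar>c\<bar>)\<^sup>2 \<ge> 0" by simp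
  then have "2 * A \<le> a\<^sup>2 + c\<^sup>2" by (simp add: power2_diff A_def abs_mult)
  moreover have "A\<^sup>2 = a\<^sup>2 * c\<^sup>2" by (simp add: A_def power_mult_distrib)
  ultimately have "(4 - a\<^sup>2) * (4 - c\<^sup>2) \<le> (4 - A)\<^sup>2"
    by (simp add: algebra_simps power2_eq_square[of "4 - A"]) (simp add: power2_eq_square)
  also have "(4 - A)\<^sup>2 + 4 * l\<^sup>2 \<le> (4 - A + 2 * l)\<^sup>2"
    using A l by (simp add: power2_sum power_mult_distrib)
  ultimately have "\<bar>2 * b - a * c\<bar>\<^sup>2 \<le> (4 - A + 2 * l)\<^sup>2"
    using sq by simp
  then have "\<bar>2 * b - a * c\<bar> \<le> 4 - A + 2 * l"
    by (rule power2_le_imp_le) (use A l in simp)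
  moreover have "2 * \<bar>b\<bar> \<le> \<bar>2 * b - a * c\<bar> + A"
    unfolding A_def by linarith
  ultimately show "\<bar>b\<bar> \<le> l + 2" by linarith
qed

section \<open>Energies with bounded even-indexed traces\<close>

text \<open>Take the last point with value \<open>- r\<close> and the first later point with value
  \<open>r\<close>; leaving the strip in between would produce another such point.\<close>

lemma subinterval_onto:
  fixes f :: "real \<Rightarrow> real"
  assumes cont: "continuous_on {p..q} f" and "p \<le> q" and fp: "f p \<le> - r" and fq: "r \<le> f q"
    and r: "r > 0"
  obtains a b where "p \<le> a" "a \<le> b" "b \<le> q" "f a = - r" "f b = r" "\<And>x. a \<le> x \<Longrightarrow> x \<le> b \<Longrightarrow> \<bar>f x\<bar> \<le> r"
proof -
  have ivt: "\<exists>x\<ge>u. x \<le> v \<and> f x = y" if "p \<le> u" "u \<le> v" "v \<le> q" "f u \<le> y" "y \<le> f v" for u v y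
  proof -
    have "continuous_on {u..v} f" using that by (intro continuous_on_subset[OF cont]) auto
    from IVT'[OF that(4,5,2) this] show ?thesis by blast
  qed
  define P where "P = {x \<in> {p..q}. f x = - r}"
  have "compact P"
  proof -
    have "closed P"
      unfolding P_def by (rule continuous_closed_preimage_constant[OF cont closed_real_atLeastAtMost])
    then have "compact ({p..q} \<inter> P)" by (rule compact_Int_closed[OF compact_Icc])
    moreover have "{p..q} \<inter> P = P" by (auto simp: P_def)
    ultimately show ?thesis by simp
  qed
  moreover have "P \<noteq> {}" using ivt[of p q "- r"] \<open>p \<le> q\<close> fp fq r by (auto simp: P_def)
  ultimately obtain a where a: "a \<in> P" "\<And>x. x \<in> P \<Longrightarrow> x \<le> a"
    using compact_attains_sup[of P] by auto
  have a': "p \<le> a" "a \<le> q" "f a = - r" using a(1) by (auto simp: P_def)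
  define Q where "Q = {x \<in> {a..q}. f x = r}"
  have "compact Q"
  proof -
    have "continuous_on {a..q} f" using a' by (intro continuous_on_subset[OF cont]) auto
    then have "closed Q"
      unfolding Q_def by (rule continuous_closed_preimage_constant[OF _ closed_real_atLeastAtMost])
    then have "compact ({a..q} \<inter> Q)" by (rule compact_Int_closed[OF compact_Icc])
    moreover have "{a..q} \<inter> Q = Q" by (auto simp: Q_def)
    ultimately show ?thesis by simp
  qed
  moreover have "Q \<noteq> {}" using ivt[of a q r] a' fq r by (auto simp: Q_def)
  ultimately obtain b where b: "b \<in> Q" "\<And>x. x \<in> Q \<Longrightarrow> b \<le> x"
    using compact_attains_inf[of Q] by auto
  have b': "a \<le> b" "b \<le> q" "f b = r" using b(1) by (auto simp: Q_def)
  have "\<bar>f x\<bar> \<le> r" if x: "a \<le> x" "x \<le> b" for x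
  proof (rule ccontr)
    assume "\<not> \<bar>f x\<bar> \<le> r"
    then consider "f x < - r" | "f x > r" by linarith
    then show False
    proof cases
      case 1
      then obtain y where y: "x \<le> y" "y \<le> b" "f y = - r"
        using ivt[of x b "- r"] x a'(1) b' r by auto
      have "y \<in> P" using y x a'(1) b'(2) by (simp add: P_def)
      then have "y \<le> a" by (rule a(2))
      then have "x = a" using y x by simp
      then show False using 1 a' by simp
    next
      case 2
      then obtain y where y: "a \<le> y" "y \<le> x" "f y = r"
        using ivt[of a x r] x a' b'(2) r by auto
      have "y \<in> Q" using y x b'(2) by (simp add: Q_def)
      then have "b \<le> y" by (rule b(2))
      then have "x = b" using y x by simp
      then show False using 2 b' by simp
    qed
  qed
  then show ?thesis by (rule that[OF a'(1) b'(1,2) a'(3) b'(3)])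
qed

lemma subinterval_onto_unordered:
  fixes f :: "real \<Rightarrow> real"
  assumes cont: "continuous_on {p..q} f" and "p \<le> q" and r: "r > 0"
    and f: "(f p \<le> - r \<and> r \<le> f q) \<or> (f q \<le> - r \<and> r \<le> f p)"
  obtains a b where "p \<le> a" "a \<le> b" "b \<le> q" "\<bar>f a\<bar> = r" "f b = - f a"
    "\<And>x. a \<le> x \<Longrightarrow> x \<le> b \<Longrightarrow> \<bar>f x\<bar> \<le> r"
  using f
proof
  assume "f p \<le> - r \<and> r \<le> f q"
  then obtain a b where "p \<le> a" "a \<le> b" "b \<le> q" "f a = - r" "f b = r"
      "\<And>x. a \<le> x \<Longrightarrow> x \<le> b \<Longrightarrow> \<bar>f x\<bar> \<le> r"
    using subinterval_onto[OF cont \<open>p \<le> q\<close> _ _ r] by blast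
  then show ?thesis using that[of a b] r by auto
next
  assume "f q \<le> - r \<and> r \<le> f p"
  moreover have "continuous_on {p..q} (\<lambda>x. - f x)" by (intro continuous_intros cont)
  ultimately obtain a b where "p \<le> a" "a \<le> b" "b \<le> q" "- f a = - r" "- f b = r"
      "\<And>x. a \<le> x \<Longrightarrow> x \<le> b \<Longrightarrow> \<bar>- f x\<bar> \<le> r"
    using subinterval_onto[of p q "\<lambda>x. - f x" r] \<open>p \<le> q\<close> r by auto
  then show ?thesis using that[of a b] r by auto
qed

text \<open>The induction carries, besides the bounds, that the latest trace takes the values 2 and
  -2 at the two ends; this supplies the energies at which the next trace is tested.\<close>

lemma fib_trace_band:
  fixes l :: real
  assumes l: "l > 4"
  shows "\<exists>u v. u \<le> v \<and> \<bar>u\<bar> \<le> l + 2 \<and> \<bar>v\<bar> \<le> l + 2 \<and>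
     (\<forall>E\<in>{u..v}. \<forall>i\<le>j. \<bar>fib_trace l E (2 * i + 2)\<bar> \<le> 2) \<and>
     \<bar>fib_trace l u (2 * j + 2)\<bar> = 2 \<and> fib_trace l v (2 * j + 2) = - fib_trace l u (2 * j + 2)"
proof (induction j)
  case 0
  show ?case
    by (rule exI[of _ "l - 2"], rule exI[of _ "l + 2"]) (use l in \<open>auto simp: numeral_2_eq_2\<close>)
next
  case (Suc j)
  then obtain u v where uv: "u \<le> v" "\<bar>u\<bar> \<le> l + 2" "\<bar>v\<bar> \<le> l + 2"
    and le2: "\<And>E i. E \<in> {u..v} \<Longrightarrow> i \<le> j \<Longrightarrow> \<bar>fib_trace l E (2 * i + 2)\<bar> \<le> 2"
    and ends: "\<bar>fib_trace l u (2 * j + 2)\<bar> = 2" "fib_trace l v (2 * j + 2) = - fib_trace l u (2 * j + 2)"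
    by blast
  define a b c d where "a E = fib_trace l E (2 * j)" and "b E = fib_trace l E (2 * j + 1)"
    and "c E = fib_trace l E (2 * j + 2)" and "d E = fib_trace l E (2 * j + 4)" for E
  have d: "d E = b E * ((c E)\<^sup>2 - 1) - a E * c E" for E
    unfolding a_def b_def c_def d_def by (rule fib_trace_step2)
  have cont: "continuous_on A a" "continuous_on A b" "continuous_on A c" "continuous_on A d" for A
    unfolding a_def b_def c_def d_def by (rule continuous_on_fib_trace)+
  have ac: "\<bar>c E\<bar> \<le> 2" "\<bar>a E\<bar> \<le> 2" if "E \<in> {u..v}" for E
  proof -
    show "\<bar>c E\<bar> \<le> 2" using le2[OF that, of j] by (simp add: c_def)
    \<comment> \<open>For \<open>j = 0\<close> this is the constant initial trace 2, about which the
      band says nothing.\<close>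
    show "\<bar>a E\<bar> \<le> 2" using le2[OF that, of "j - 1"] by (cases j) (simp_all add: a_def)
  qed
  have b2: "2 < \<bar>b E\<bar>" if "E \<in> {u..v}" for E
    using middle_trace_bounds(1)[of "c E" "b E" "a E" l] fib_trace_invariant[of l E "2 * j"] ac[OF that] l
    unfolding a_def b_def c_def by simp
  \<comment> \<open>Where \<open>c = 0\<close> the next trace is \<open>- b\<close>, and where
    \<open>c = 2\<close> it is \<open>3 * b - 2 * a\<close>. As \<open>b\<close> keeps one sign with
    modulus above 2 and \<open>a\<close> has modulus at most 2, these values lie on opposite sides
    of the interval from -2 to 2.\<close>
  obtain E0 where E0: "E0 \<in> {u..v}" "c E0 = 0"
  proof (cases "c u \<le> 0")
    case True
    then show ?thesis using IVT'[of c u 0 v] ends uv cont that by (auto simp: c_def)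
  next
    case False
    then show ?thesis using IVT2'[of c v 0 u] ends uv cont that by (auto simp: c_def)
  qed
  obtain E1 where E1: "E1 \<in> {u..v}" "c E1 = 2"
  proof (cases "c u = 2")
    case True
    then show ?thesis using that[of u] uv by simp
  next
    case False
    then show ?thesis using that[of v] uv ends by (auto simp: c_def abs_if split: if_splits)
  qed
  have dE: "d E0 = - b E0" "d E1 = 3 * b E1 - 2 * a E1"
    by (simp_all add: d E0 E1)
  define p q where "p = min E0 E1" and "q = max E0 E1"
  have pq: "p \<le> q" "u \<le> p" "q \<le> v" using E0 E1 by (auto simp: p_def q_def)
  have same: "(b E0 > 2 \<and> b E1 > 2) \<or> (b E0 < - 2 \<and> b E1 < - 2)"
  proof (rule ccontr)
    assume "\<not> ?thesis"
    then have "(b E0 \<le> 0 \<and> 0 \<le> b E1) \<or> (b E1 \<le> 0 \<and> 0 \<le> b E0)"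
      using b2[OF E0(1)] b2[OF E1(1)] by linarith
    then have "(b p \<le> 0 \<and> 0 \<le> b q) \<or> (b q \<le> 0 \<and> 0 \<le> b p)"
      by (auto simp: p_def q_def min_def max_def)
    then obtain x where "x \<in> {p..q}" "b x = 0"
      using IVT'[of b p 0 q] IVT2'[of b q 0 p] cont pq by auto
    then show False using b2[of x] pq by auto
  qed
  have "(d E0 \<le> - 2 \<and> 2 \<le> d E1) \<or> (d E1 \<le> - 2 \<and> 2 \<le> d E0)"
    using same dE ac(2)[OF E1(1)] by linarith
  then have "(d p \<le> - 2 \<and> 2 \<le> d q) \<or> (d q \<le> - 2 \<and> 2 \<le> d p)"
    by (auto simp: p_def q_def min_def max_def)
  then obtain u' v' where uv': "p \<le> u'" "u' \<le> v'" "v' \<le> q" "\<bar>d u'\<bar> = 2" "d v' = - d u'"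
      "\<And>x. u' \<le> x \<Longrightarrow> x \<le> v' \<Longrightarrow> \<bar>d x\<bar> \<le> 2"
    using subinterval_onto_unordered[OF cont(4)[of "{p..q}"] pq(1), of 2] by auto
  have "\<bar>fib_trace l E (2 * i + 2)\<bar> \<le> 2" if "E \<in> {u'..v'}" "i \<le> Suc j" for E i
  proof (cases "i = Suc j")
    case True
    then show ?thesis using uv'(6)[of E] that by (simp add: d_def eval_nat_numeral)
  next
    case False
    then show ?thesis using le2[of E i] that uv' pq by auto
  qed
  moreover have "2 * Suc j + 2 = 2 * j + 4" by simp
  then have "\<bar>fib_trace l u' (2 * Suc j + 2)\<bar> = 2" "fib_trace l v' (2 * Suc j + 2) = - fib_trace l u' (2 * Suc j + 2)"
    using uv' unfolding d_def by (simp_all only:)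
  moreover have "\<bar>u'\<bar> \<le> l + 2" "\<bar>v'\<bar> \<le> l + 2" using uv' pq uv by linarith+
  ultimately show ?case
    using uv'(2) by (intro exI[of _ u'] exI[of _ v'] conjI ballI allI impI) blast+
qed

corollary ex_bounded_traces:
  fixes l :: real
  assumes "l > 4"
  obtains E where "\<bar>E\<bar> \<le> l + 2" "\<And>i. i \<le> J \<Longrightarrow> \<bar>fib_trace l E (2 * i + 2)\<bar> \<le> 2"
  using fib_trace_band[OF assms, of J] by (metis atLeastAtMost_iff order_refl)

section \<open>Stability of bounded traces under complex energies\<close>

text \<open>The derivative in \<open>c\<close> of the next trace. The bound on that trace makes
  \<open>b * (c^2 - 1)\<close> at most 6 in modulus, so \<open>(b * c)^2\<close> is at most
  \<open>b^2\<close> plus 6 times the modulus of \<open>b\<close>.\<close>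

lemma trace_expansion_factor:
  fixes a b c l :: real
  assumes "\<bar>a\<bar> \<le> 2" "\<bar>b\<bar> \<le> l + 2" "\<bar>c\<bar> \<le> 2" "\<bar>b * (c\<^sup>2 - 1) - a * c\<bar> \<le> 2"
  shows "\<bar>2 * b * c - a\<bar> \<le> 2 * l + 12"
proof -
  have "\<bar>a * c\<bar> \<le> 4" using mult_mono[OF assms(1,3)] by (simp add: abs_mult)
  then have "\<bar>b * (c\<^sup>2 - 1)\<bar> \<le> 6" using assms(4) by linarith
  then have "\<bar>b\<bar> * \<bar>b * (c\<^sup>2 - 1)\<bar> \<le> \<bar>b\<bar> * 6" by (intro mult_left_mono) auto
  moreover have "b * (b * (c\<^sup>2 - 1)) \<le> \<bar>b\<bar> * \<bar>b * (c\<^sup>2 - 1)\<bar>"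
    by (metis abs_ge_self abs_mult)
  ultimately have "\<bar>b * c\<bar>\<^sup>2 \<le> (\<bar>b\<bar> + 3)\<^sup>2"
    by (simp add: power2_eq_square algebra_simps)
  then have "\<bar>b * c\<bar> \<le> \<bar>b\<bar> + 3" by (rule power2_le_imp_le) simp
  then show ?thesis using assms(1,2) by linarith
qed

text \<open>
  One double step of the trace map expands errors by at most \<open>2 * l + 17\<close> to first order; the gap to
  \<open>S_u l\<close> absorbs the higher-order terms.
\<close>

lemma trace_perturbation_step:
  fixes a b c l e :: real and da db dc :: complex
  assumes abc: "\<bar>a\<bar> \<le> 2" "\<bar>b\<bar> \<le> l + 2" "\<bar>c\<bar> \<le> 2" "\<bar>b * (c\<^sup>2 - 1) - a * c\<bar> \<le> 2" and l: "l > 0"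
    and d: "cmod da \<le> e" "cmod db \<le> e" "cmod dc \<le> e" and e: "e \<le> 1 / (l + 12)"
  shows "cmod ((c + dc) * (b + db) - (a + da) - (c * b - a)) \<le> S_u l * e"
    and "cmod ((b + db) * ((c + dc)\<^sup>2 - 1) - (a + da) * (c + dc) - (b * (c\<^sup>2 - 1) - a * c)) \<le> S_u l * e"
proof -
  have e0: "0 \<le> e" using d(1) norm_ge_zero order_trans by blast
  have el: "(l + 12) * e \<le> 1" using e l by (simp add: field_simps)
  have le0: "0 \<le> l * e" using e0 l by simp
  have e1: "e \<le> 1 / 12" using el le0 by (simp add: algebra_simps)
  have ee: "e * e \<le> e" using mult_right_mono[OF e1 e0] e0 by simp
  have "(c + dc) * (b + db) - (a + da) - (c * b - a) = c * db + b * dc + dc * db - da"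
    by (simp add: algebra_simps)
  also have "cmod \<dots> \<le> cmod (c * db) + cmod (b * dc) + cmod (dc * db) + cmod da"
    by (intro order_trans[OF norm_triangle_ineq4] add_mono order_trans[OF norm_triangle_ineq] order_refl)
  also have "\<dots> \<le> 2 * e + (l + 2) * e + e * e + e"
    unfolding norm_mult norm_of_real using abc d e0 l by (intro add_mono mult_mono) auto
  also have "\<dots> \<le> S_u l * e"
    using ee e0 le0 by (simp add: S_u_def algebra_simps)
  finally show "cmod ((c + dc) * (b + db) - (a + da) - (c * b - a)) \<le> S_u l * e" .
  have "c\<^sup>2 \<le> 4" using power_mono[OF abc(3), of 2] by simp
  then have c3: "\<bar>c\<^sup>2 - 1\<bar> \<le> 3" by (simp add: abs_if) (use zero_le_power2[of c] in linarith)
  have "(b + db) * ((c + dc)\<^sup>2 - 1) - (a + da) * (c + dc) - (b * (c\<^sup>2 - 1) - a * c)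
     = of_real (c\<^sup>2 - 1) * db + of_real (2 * b * c - a) * dc + of_real b * (dc * dc)
       + db * (of_real (2 * c) * dc + dc * dc) - of_real c * da - da * dc"
    by (simp add: algebra_simps power2_eq_square)
  also have "cmod \<dots> \<le> cmod (of_real (c\<^sup>2 - 1) * db) + cmod (of_real (2 * b * c - a) * dc)
      + cmod (of_real b * (dc * dc))
      + cmod (db * (of_real (2 * c) * dc + dc * dc)) + cmod (of_real c * da) + cmod (da * dc)"
    by (intro order_trans[OF norm_triangle_ineq4] add_mono order_trans[OF norm_triangle_ineq] order_refl)
  also have "\<dots> \<le> 3 * e + (2 * l + 12) * e + (l + 2) * (e * e) + e * (4 * e + e * e) + 2 * e + e * e"
  proof (intro add_mono)
    have "cmod (of_real (2 * c) * dc + dc * dc) \<le> cmod (of_real (2 * c) * dc) + cmod (dc * dc)"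
      by (rule norm_triangle_ineq)
    also have "\<dots> \<le> 4 * e + e * e"
      unfolding norm_mult norm_of_real using abc d e0 by (intro add_mono mult_mono) auto
    finally show "cmod (db * (of_real (2 * c) * dc + dc * dc)) \<le> e * (4 * e + e * e)"
      unfolding norm_mult[of db] using d e0 by (intro mult_mono) auto
    show "cmod (complex_of_real (2 * b * c - a) * dc) \<le> (2 * l + 12) * e"
      unfolding norm_mult norm_of_real
      using trace_expansion_factor[OF abc] d e0 l by (intro mult_mono) auto
  qed (unfold norm_mult norm_of_real, use abc c3 d e0 l in \<open>auto intro!: mult_mono\<close>)
  \<comment> \<open>The linear terms add up to \<open>3 + (2 * l + 12) + 2\<close>. The threshold
    \<open>1 / (l + 12)\<close> for \<open>e\<close> keeps the second bracket, which holds all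
    higher-order terms, at most 1.\<close>
  also have "\<dots> = e * ((2 * l + 17) + ((l + 12) * e - 5 * e + e * e))"
    by (simp add: algebra_simps)
  also have "\<dots> \<le> e * S_u l"
    using el e0 ee e1 by (intro mult_left_mono) (auto simp: S_u_def)
  finally show "cmod ((b + db) * ((c + dc)\<^sup>2 - 1) - (a + da) * (c + dc) - (b * (c\<^sup>2 - 1) - a * c)) \<le> S_u l * e"
    by (simp add: mult.commute)
qed

text \<open>Errors are carried for three consecutive traces, which determine the triple two steps
  later. The unperturbed odd-indexed traces are not bounded by 2; the invariant bounds them by
  \<open>l + 2\<close>.\<close>

lemma fib_trace_perturbation:
  fixes l E e :: real
  assumes l: "l > 4" and E: "\<And>i. i \<le> J \<Longrightarrow> \<bar>fib_trace l E (2 * i + 2)\<bar> \<le> 2"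
    and e: "0 \<le> e" "e * S_u l ^ J \<le> 1 / (l + 12)" and j: "j \<le> J"
  defines "X \<equiv> fib_trace (complex_of_real l) (of_real E + \<i> * of_real e)" and "Y \<equiv> fib_trace l E"
  shows "cmod (X (2 * j) - Y (2 * j)) \<le> e * S_u l ^ j \<and> cmod (X (2 * j + 1) - Y (2 * j + 1)) \<le> e * S_u l ^ j
    \<and> cmod (X (2 * j + 2) - Y (2 * j + 2)) \<le> e * S_u l ^ j"
  using j
proof (induction j)
  case 0
  then show ?case using e by (simp add: X_def Y_def numeral_2_eq_2 norm_mult)
next
  case (Suc j)
  define d where "d n = X n - Y n" for n
  have X: "X n = Y n + d n" for n by (simp add: d_def)
  have S: "S_u l \<ge> 1" using l by (simp add: S_u_def)
  have IH: "cmod (d (2 * j)) \<le> e * S_u l ^ j" "cmod (d (2 * j + 1)) \<le> e * S_u l ^ j"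
    "cmod (d (2 * j + 2)) \<le> e * S_u l ^ j"
    using Suc by (auto simp: d_def)
  have "e * S_u l ^ j \<le> e * S_u l ^ J"
    using Suc.prems S e by (intro mult_left_mono power_increasing) auto
  then have small: "e * S_u l ^ j \<le> 1 / (l + 12)" using e by linarith
  have ac: "\<bar>Y (2 * j)\<bar> \<le> 2" "\<bar>Y (2 * j + 2)\<bar> \<le> 2" "\<bar>Y (2 * j + 4)\<bar> \<le> 2"
  proof -
    show "\<bar>Y (2 * j)\<bar> \<le> 2" using E[of "j - 1"] Suc.prems by (cases j) (auto simp: Y_def)
    show "\<bar>Y (2 * j + 2)\<bar> \<le> 2" using E[of j] Suc.prems by (auto simp: Y_def)
    show "\<bar>Y (2 * j + 4)\<bar> \<le> 2" using E[of "Suc j"] Suc.prems by (auto simp: Y_def eval_nat_numeral)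
  qed
  have b: "\<bar>Y (2 * j + 1)\<bar> \<le> l + 2"
    using middle_trace_bounds(2)[of "Y (2 * j + 2)" "Y (2 * j + 1)" "Y (2 * j)" l]
      fib_trace_invariant[of l E "2 * j"] ac l unfolding Y_def by simp
  have Y4: "Y (2 * j + 4) = Y (2 * j + 1) * ((Y (2 * j + 2))\<^sup>2 - 1) - Y (2 * j) * Y (2 * j + 2)"
    unfolding Y_def by (rule fib_trace_step2)
  have X4: "X (2 * j + 4) = X (2 * j + 1) * ((X (2 * j + 2))\<^sup>2 - 1) - X (2 * j) * X (2 * j + 2)"
    unfolding X_def by (rule fib_trace_step2)
  have XY3: "X (2 * j + 3) = X (2 * j + 2) * X (2 * j + 1) - X (2 * j)"
    "Y (2 * j + 3) = Y (2 * j + 2) * Y (2 * j + 1) - Y (2 * j)"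
    by (simp_all add: X_def Y_def eval_nat_numeral)
  have l0: "l > 0" using l by simp
  note step = trace_perturbation_step[OF ac(1) b ac(2) ac(3)[unfolded Y4] l0 IH small, folded X]
  have "cmod (X (2 * j + 3) - Y (2 * j + 3)) \<le> e * S_u l ^ Suc j"
    using step(1) unfolding XY3 by (simp add: mult_ac)
  moreover have "cmod (X (2 * j + 4) - Y (2 * j + 4)) \<le> e * S_u l ^ Suc j"
    using step(2) unfolding X4 Y4 by (simp add: mult_ac)
  moreover have "cmod (X (2 * j + 2) - Y (2 * j + 2)) \<le> e * S_u l ^ Suc j"
  proof -
    have "e * S_u l ^ j \<le> e * S_u l ^ Suc j"
      using S e by (intro mult_left_mono power_increasing) auto
    then show ?thesis using IH(3) unfolding d_def by linarith
  qed
  moreover have "2 * Suc j = 2 * j + 2" "2 * Suc j + 1 = 2 * j + 3" "2 * Suc j + 2 = 2 * j + 4" by simp_all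
  ultimately show ?case by (simp only:)
qed

section \<open>Transfer matrices and growth of solutions\<close>

definition step_matrix :: "complex \<Rightarrow> complex^2^2" where
  "step_matrix x = vector [vector [x, - 1], vector [1, 0]]"

fun transfer_matrix :: "real \<Rightarrow> complex \<Rightarrow> nat \<Rightarrow> complex^2^2" where
  "transfer_matrix l z 0 = mat 1"
| "transfer_matrix l z (Suc n) =
     step_matrix (z - of_real (fib_potential l (int (Suc n)))) ** transfer_matrix l z n"

text \<open>The eigenvalue equation is imposed at sites from 1 on only, so site 0, where the source
  sits, does not enter.\<close>

definition solution :: "real \<Rightarrow> complex \<Rightarrow> (nat \<Rightarrow> complex) \<Rightarrow> bool" where
  "solution l z w \<longleftrightarrow>
     (\<forall>n. w (Suc (Suc n)) = (z - of_real (fib_potential l (int (Suc n)))) * w (Suc n) - w n)"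

lemma step_matrix_nth [simp]:
  "step_matrix x $ 1 $ 1 = x" "step_matrix x $ 1 $ 2 = - 1"
  "step_matrix x $ 2 $ 1 = 1" "step_matrix x $ 2 $ 2 = 0"
  by (simp_all add: step_matrix_def)

lemma det_transfer_matrix: "det (transfer_matrix l z n) = 1"
proof (induction n)
  case (Suc n)
  have "det (step_matrix x) = 1" for x by (simp add: det_2)
  then show ?case using Suc by (simp add: det_mul)
qed (simp add: det_I)

section \<open>Unimodular matrices and the Fibonacci factorisation\<close>

lemma matrix_mult_nth_2: "((A :: complex^2^2) ** B) $ i $ j = A $ i $ 1 * B $ 1 $ j + A $ i $ 2 * B $ 2 $ j"
  by (simp add: matrix_matrix_mult_def sum_2)

lemma trace_2: "trace (A :: complex^2^2) = A $ 1 $ 1 + A $ 2 $ 2"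
  by (simp add: trace_def sum_2)

lemma cayley_hamilton_2:
  fixes M :: "complex^2^2"
  assumes "det M = 1"
  shows "((M ** M) *v x) $ i - trace M * (M *v x) $ i + x $ i = 0"
proof -
  have d: "M $ 1 $ 1 * M $ 2 $ 2 = 1 + M $ 1 $ 2 * M $ 2 $ 1" using assms by (simp add: det_2 algebra_simps)
  consider "i = 1" | "i = 2" using exhaust_2 by blast
  then show ?thesis
  proof cases
    case 1
    have "((M ** M) *v x) $ i - trace M * (M *v x) $ i + x $ i
       = (1 + M $ 1 $ 2 * M $ 2 $ 1 - M $ 1 $ 1 * M $ 2 $ 2) * x $ 1"
      by (simp add: 1 matrix_vector_mult_def sum_2 matrix_mult_nth_2 trace_2 algebra_simps)
    then show ?thesis using d by simp
  next
    case 2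
    have "((M ** M) *v x) $ i - trace M * (M *v x) $ i + x $ i
       = (1 + M $ 1 $ 2 * M $ 2 $ 1 - M $ 1 $ 1 * M $ 2 $ 2) * x $ 2"
      by (simp add: 2 matrix_vector_mult_def sum_2 matrix_mult_nth_2 trace_2 algebra_simps)
    then show ?thesis using d by simp
  qed
qed

text \<open>Under the trace, Cayley-Hamilton replaces \<open>B ** B\<close> by
  \<open>trace B\<close> times \<open>B\<close> minus the identity; this is the source of the trace
  map.\<close>

lemma trace_mult_2:
  fixes A B :: "complex^2^2"
  assumes "det B = 1"
  shows "trace (B ** (A ** B)) = trace (A ** B) * trace B - trace A"
proof -
  have d: "B $ 1 $ 1 * B $ 2 $ 2 = 1 + B $ 1 $ 2 * B $ 2 $ 1" using assms by (simp add: det_2 algebra_simps)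
  have "trace (B ** (A ** B)) - trace (A ** B) * trace B =
     - (B $ 1 $ 1 * B $ 2 $ 2 - B $ 1 $ 2 * B $ 2 $ 1) * trace A"
    by (simp add: matrix_mult_nth_2 trace_2 algebra_simps)
  then show ?thesis using d by (simp add: algebra_simps)
qed

lemma transfer_matrix_solution:
  assumes "solution l z w"
  shows "transfer_matrix l z n *v vector [w 1, w 0] = vector [w (Suc n), w n]"
proof (induction n)
  case 0
  show ?case by (simp add: matrix_vector_mul_lid)
next
  case (Suc n)
  show ?case
    using assms unfolding solution_def transfer_matrix.simps matrix_vector_mul_assoc[symmetric] Suc
    by (simp add: vec_eq_iff forall_2 matrix_vector_mult_def sum_2 del: of_nat_Suc)
qed

lemma transfer_matrix_add:
  assumes "\<And>i. 1 \<le> i \<Longrightarrow> i \<le> n \<Longrightarrow> fib_potential l (int (i + q)) = fib_potential l (int i)"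
  shows "transfer_matrix l z (n + q) = transfer_matrix l z n ** transfer_matrix l z q"
  using assms
proof (induction n)
  case (Suc n)
  have "fib_potential l (int (Suc (n + q))) = fib_potential l (int (Suc n))"
    using Suc.prems[of "Suc n"] by simp
  then show ?case
    using Suc by (simp add: matrix_mul_assoc del: of_nat_Suc)
qed simp

text \<open>
  \<open>m = 1\<close> is exceptional: the corresponding one-letter word is not a prefix of the potential.
\<close>

definition word_matrix :: "real \<Rightarrow> complex \<Rightarrow> nat \<Rightarrow> complex^2^2" where
  "word_matrix l z m = (if m = 1 then step_matrix z else transfer_matrix l z (fib m))"

lemma two_le_fib: "3 \<le> m \<Longrightarrow> 2 \<le> fib m"
  using fib_mono[of 3 m] by (simp add: eval_nat_numeral)

text \<open>The word of length \<open>fib (m + 1)\<close> is the word of length \<open>fib m\<close>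
  followed by that of length \<open>fib (m - 1)\<close>; later letters multiply from the left. For
  \<open>m = 2\<close> the word is \<open>l, 0\<close>, and the exceptional matrix stands for its
  second letter.\<close>

lemma word_matrix_Suc:
  assumes "2 \<le> m"
  shows "word_matrix l z (Suc m) = word_matrix l z (m - 1) ** word_matrix l z m"
proof (cases "m = 2")
  case True
  then show ?thesis using fib_potential_2[of l] by (simp add: word_matrix_def eval_nat_numeral)
next
  case False
  then obtain k where m: "m = Suc k" "k \<ge> 2" using assms by (cases m) auto
  have "transfer_matrix l z (fib k + fib m) = transfer_matrix l z (fib k) ** transfer_matrix l z (fib m)"
  proof (rule transfer_matrix_add)
    fix i assume "1 \<le> i" "i \<le> fib k"
    then show "fib_potential l (int (i + fib m)) = fib_potential l (int i)"
      unfolding m(1) using two_le_fib[of "Suc k"] m by (intro fib_potential_period) auto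
  qed
  then show ?thesis using m by (simp add: word_matrix_def add.commute)
qed

lemma trace_word_matrix:
  assumes "1 \<le> m"
  shows "trace (word_matrix l z m) = fib_trace (of_real l) z m"
  using assms
proof (induction m rule: less_induct)
  case (less m)
  have one: "word_matrix l z 1 = step_matrix z" and two: "word_matrix l z 2 = step_matrix (z - of_real l)"
    using fib_potential_1[of l] by (auto simp: word_matrix_def numeral_2_eq_2)
  show ?case
  proof (cases "m \<le> 3")
    case True
    then consider "m = 1" | "m = 2" | "m = 3" using less.prems by linarith
    then show ?thesis
    proof cases
      case 3
      have "word_matrix l z 3 = step_matrix z ** step_matrix (z - of_real l)"
        using word_matrix_Suc[of 2 l z] one two by simp
      then show ?thesis using 3 by (simp add: trace_2 matrix_mult_nth_2 eval_nat_numeral algebra_simps)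
    qed (use one two in \<open>simp_all add: trace_2 numeral_2_eq_2\<close>)
  next
    case False
    define n where "n = m - 4"
    have n: "m = Suc (Suc (Suc (Suc n)))" using False by (simp add: n_def)
    define A where "A = word_matrix l z (n + 1)"
    define B where "B = word_matrix l z (n + 2)"
    have 3: "word_matrix l z (n + 3) = A ** B"
      using word_matrix_Suc[of "n + 2" l z] by (simp add: A_def B_def eval_nat_numeral)
    have 4: "word_matrix l z (n + 4) = B ** (A ** B)"
      using word_matrix_Suc[of "n + 3" l z] 3 by (simp add: B_def eval_nat_numeral)
    have "det B = 1" by (simp add: B_def word_matrix_def det_transfer_matrix)
    then have "trace (word_matrix l z (n + 4)) = trace (word_matrix l z (n + 3)) * trace B - trace A"
      unfolding 4 3 by (rule trace_mult_2)
    also have "\<dots> = fib_trace (of_real l) z (n + 3) * fib_trace (of_real l) z (n + 2) - fib_trace (of_real l) z (n + 1)"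
      unfolding A_def B_def using less.IH[of "n + 3"] less.IH[of "n + 2"] less.IH[of "n + 1"] n by simp
    finally show ?thesis by (simp add: n eval_nat_numeral)
  qed
qed

section \<open>The two-block argument and the growth of mass\<close>

text \<open>At the first two sites this is Cayley-Hamilton for one period followed by its
  repetition. The repetition of the potential continues beyond that square, so the defect
  \<open>D\<close> obeys the same recurrence and stays 0 for \<open>fib (m - 1)\<close>
  sites.\<close>

lemma solution_two_block:
  assumes w: "solution l z w" and m: "4 \<le> m" and n: "n < fib (m - 1)"
  shows "w (n + 2 * fib m) - fib_trace (of_real l) z m * w (n + fib m) + w n = 0"
proof -
  define q where "q = fib m"
  define t where "t = fib_trace (complex_of_real l) z m"
  define D where "D n = w (n + 2 * q) - t * w (n + q) + w n" for n
  have fm: "fib (Suc m) = q + fib (m - 1)" "fib (m - 1) \<ge> 2"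
    using m two_le_fib[of "m - 1"] by (cases m; simp add: q_def)+
  have V: "fib_potential l (int (i + q)) = fib_potential l (int i)" if "1 \<le> i" "i + 1 < q + fib (m - 1)" for i
  proof -
    obtain k where k: "m = Suc k" using m by (cases m) auto
    show ?thesis
      using fib_potential_period[of i k l] that fm(1) unfolding q_def k by simp
  qed
  have P: "transfer_matrix l z (q + q) = transfer_matrix l z q ** transfer_matrix l z q"
    using V fm by (intro transfer_matrix_add) auto
  define M where "M = transfer_matrix l z q"
  have M: "trace M = t" "det M = 1"
    using trace_word_matrix[of m l z] m
    by (simp_all add: M_def t_def q_def word_matrix_def det_transfer_matrix)
  have D0: "D 0 = 0" and D1: "D 1 = 0"
    using cayley_hamilton_2[OF M(2), of "vector [w 1, w 0]" 1] cayley_hamilton_2[OF M(2), of "vector [w 1, w 0]" 2]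
      transfer_matrix_solution[OF w, of q] transfer_matrix_solution[OF w, of "q + q"]
    unfolding M(1) unfolding M_def P[symmetric] D_def by (simp_all add: mult_2)
  have "D n = 0 \<and> (n + 1 < fib (m - 1) \<longrightarrow> D (n + 1) = 0)" if "n < fib (m - 1)" for n
    using that
  proof (induction n)
    case 0
    then show ?case using D0 D1 by simp
  next
    case (Suc n)
    have IH: "D n = 0" "D (Suc n) = 0" using Suc by auto
    have "D (Suc (Suc n)) = 0" if less: "Suc (Suc n) < fib (m - 1)"
    proof -
      have v1: "fib_potential l (int (Suc (n + q))) = fib_potential l (int (Suc n))"
        using V[of "Suc n"] less by simp
      have "fib_potential l (int (Suc (n + q) + q)) = fib_potential l (int (Suc (n + q)))"
        using less by (intro V) auto
      then have v2: "fib_potential l (int (Suc (n + 2 * q))) = fib_potential l (int (Suc n))"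
        unfolding v1 by (simp add: algebra_simps mult_2)
      have "D (Suc (Suc n)) = (z - of_real (fib_potential l (int (Suc n)))) * D (Suc n) - D n"
        unfolding D_def add_Suc
          w[unfolded solution_def, rule_format, of n] w[unfolded solution_def, rule_format, of "n + q", unfolded v1]
          w[unfolded solution_def, rule_format, of "n + 2 * q", unfolded v2]
        by (simp add: algebra_simps del: of_nat_Suc)
      then show ?thesis using IH by simp
    qed
    then show ?case using IH by simp
  qed
  then show ?thesis using n by (simp add: D_def q_def t_def)
qed

text \<open>Cauchy-Schwarz for the coefficients \<open>t\<close> and 1, whence the factor
  \<open>6 = 5 + 1\<close>.\<close>

lemma two_block_bound:
  fixes x y u t :: complex
  assumes "y - t * x + u = 0" and t: "(cmod t)\<^sup>2 \<le> 5"
  shows "(cmod u)\<^sup>2 \<le> 6 * ((cmod x)\<^sup>2 + (cmod y)\<^sup>2)"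
proof -
  have "u = t * x - y" using assms(1) by (simp add: algebra_simps add_eq_0_iff2)
  then have "cmod u \<le> cmod t * cmod x + cmod y"
    using norm_triangle_ineq4[of "t * x" y] by (simp add: norm_mult)
  then have "(cmod u)\<^sup>2 \<le> (cmod t * cmod x + cmod y)\<^sup>2" by (intro power_mono) auto
  also have "\<dots> \<le> ((cmod t)\<^sup>2 + 1) * ((cmod x)\<^sup>2 + (cmod y)\<^sup>2)"
    using zero_le_power2[of "cmod t * cmod y - cmod x"]
    by (simp add: power2_sum power2_diff power_mult_distrib algebra_simps)
  also have "\<dots> \<le> 6 * ((cmod x)\<^sup>2 + (cmod y)\<^sup>2)" using t by (intro mult_right_mono) auto
  finally show ?thesis .
qed

text \<open>Since \<open>fib (m + 2) = 2 * fib m + fib (m - 1)\<close>, the translates of the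
  initial window by one and two periods are disjoint and both fit into the target window.\<close>

lemma solution_mass_block:
  assumes w: "solution l z w" and m: "4 \<le> m" and t: "(cmod (fib_trace (of_real l) z m))\<^sup>2 \<le> 5"
  shows "(\<Sum>n<fib (m - 1). (cmod (w n))\<^sup>2) \<le> 6 * (\<Sum>n\<in>{fib m..<fib (m + 2)}. (cmod (w n))\<^sup>2)"
proof -
  define N where "N = fib (m - 1)"
  define q where "q = fib m"
  have q: "N \<le> q" "fib (m + 2) = 2 * q + N"
    using m by (cases m; auto simp: N_def q_def intro: fib_mono)+
  have "(\<Sum>n<N. (cmod (w n))\<^sup>2) \<le> (\<Sum>n<N. 6 * ((cmod (w (n + q)))\<^sup>2 + (cmod (w (n + 2 * q)))\<^sup>2))"
    using solution_two_block[OF w m] t by (intro sum_mono two_block_bound) (auto simp: N_def q_def)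
  also have "\<dots> = 6 * ((\<Sum>n\<in>{0..<N}. (cmod (w (n + q)))\<^sup>2) + (\<Sum>n\<in>{0..<N}. (cmod (w (n + 2 * q)))\<^sup>2))"
    by (simp add: sum_distrib_left sum.distrib lessThan_atLeast0)
  also have "\<dots> = 6 * ((\<Sum>n\<in>{q..<q + N}. (cmod (w n))\<^sup>2) + (\<Sum>n\<in>{2 * q..<2 * q + N}. (cmod (w n))\<^sup>2))"
    using sum.shift_bounds_nat_ivl[of "\<lambda>n. (cmod (w n))\<^sup>2" 0 q N]
      sum.shift_bounds_nat_ivl[of "\<lambda>n. (cmod (w n))\<^sup>2" 0 "2 * q" N] by (simp add: add.commute)
  also have "\<dots> = 6 * (\<Sum>n\<in>{q..<q + N} \<union> {2 * q..<2 * q + N}. (cmod (w n))\<^sup>2)"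
    using q by (subst sum.union_disjoint) auto
  also have "\<dots> \<le> 6 * (\<Sum>n\<in>{q..<2 * q + N}. (cmod (w n))\<^sup>2)"
    using q by (intro mult_left_mono sum_mono2) auto
  finally show ?thesis unfolding q(2) N_def[symmetric] q_def[symmetric] .
qed

text \<open>The block carries at least a sixth of the initial mass and is disjoint from the initial
  window, so raising \<open>j\<close> by 2 gains a factor \<open>7/6\<close>, which is at least
  \<open>(17/16)^2\<close>. The rate \<open>17/16\<close> is the square of the claim's
  \<open>sqrt 17 / 4\<close>; dividing by \<open>(17/16)^2\<close> makes \<open>j \<le> 2\<close>
  trivial.\<close>

lemma solution_mass_growth:
  assumes w: "solution l z w"
    and t: "\<And>i. 1 \<le> i \<Longrightarrow> i \<le> J \<Longrightarrow> (cmod (fib_trace (of_real l) z (2 * i + 2)))\<^sup>2 \<le> 5"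
    and j: "1 \<le> j" "j \<le> J + 2"
  shows "(17 / 16) ^ j / (17 / 16)\<^sup>2 * ((cmod (w 0))\<^sup>2 + (cmod (w 1))\<^sup>2) \<le> (\<Sum>n<fib (2 * j + 1). (cmod (w n))\<^sup>2)"
  using j
proof (induction j rule: less_induct)
  case (less j)
  have base: "(cmod (w 0))\<^sup>2 + (cmod (w 1))\<^sup>2 \<le> (\<Sum>n<fib (2 * j + 1). (cmod (w n))\<^sup>2)"
  proof -
    have "(\<Sum>n<2. (cmod (w n))\<^sup>2) \<le> (\<Sum>n<fib (2 * j + 1). (cmod (w n))\<^sup>2)"
      using two_le_fib[of "2 * j + 1"] less.prems by (intro sum_mono2) auto
    then show ?thesis by (simp add: numeral_2_eq_2)
  qed
  show ?case
  proof (cases "j \<le> 2")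
    case True
    have "(17 / 16) ^ j \<le> (17 / 16 :: real)\<^sup>2" using True by (intro power_increasing) auto
    then have "(17 / 16) ^ j / (17 / 16 :: real)\<^sup>2 * ((cmod (w 0))\<^sup>2 + (cmod (w 1))\<^sup>2)
        \<le> 1 * ((cmod (w 0))\<^sup>2 + (cmod (w 1))\<^sup>2)"
      by (intro mult_right_mono) (auto simp: divide_simps)
    then show ?thesis using base by simp
  next
    case False
    define i where "i = j - 2"
    have ij: "j = i + 2" "1 \<le> i" "i \<le> J" using False less.prems by (auto simp: i_def)
    define c where "c = (17 / 16) ^ i / (17 / 16)\<^sup>2 * ((cmod (w 0))\<^sup>2 + (cmod (w 1))\<^sup>2)"
    define s where "s = (\<Sum>n<fib (2 * i + 1). (cmod (w n))\<^sup>2)"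
    have s: "c \<le> s" unfolding c_def s_def using less.IH[of i] ij by simp
    have "0 \<le> c" by (simp add: c_def)
    have "s \<le> 6 * (\<Sum>n\<in>{fib (2 * i + 2)..<fib (2 * i + 4)}. (cmod (w n))\<^sup>2)"
      using solution_mass_block[OF w, of "2 * i + 2"] t[of i] ij by (simp add: s_def eval_nat_numeral)
    moreover have "s + (\<Sum>n\<in>{fib (2 * i + 2)..<fib (2 * i + 4)}. (cmod (w n))\<^sup>2)
        \<le> (\<Sum>n<fib (2 * j + 1). (cmod (w n))\<^sup>2)"
    proof -
      have f: "fib (2 * i + 1) \<le> fib (2 * i + 2)" "fib (2 * i + 2) \<le> fib (2 * i + 4)" "fib (2 * i + 4) \<le> fib (2 * j + 1)"
        using ij by (auto intro!: fib_mono simp del: fib.simps)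
      have "s + (\<Sum>n\<in>{fib (2 * i + 2)..<fib (2 * i + 4)}. (cmod (w n))\<^sup>2)
          = (\<Sum>n\<in>{..<fib (2 * i + 1)} \<union> {fib (2 * i + 2)..<fib (2 * i + 4)}. (cmod (w n))\<^sup>2)"
        unfolding s_def using f by (subst sum.union_disjoint) auto
      also have "\<dots> \<le> (\<Sum>n<fib (2 * j + 1). (cmod (w n))\<^sup>2)"
        using f by (intro sum_mono2) auto
      finally show ?thesis .
    qed
    ultimately have "7 / 6 * c \<le> (\<Sum>n<fib (2 * j + 1). (cmod (w n))\<^sup>2)"
      using s by linarith
    moreover have "(17 / 16) ^ j / (17 / 16)\<^sup>2 * ((cmod (w 0))\<^sup>2 + (cmod (w 1))\<^sup>2) = (17 / 16)\<^sup>2 * c"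
      by (simp add: c_def ij power_add power2_eq_square mult_ac)
    moreover have "(17 / 16)\<^sup>2 * c \<le> 7 / 6 * c"
      using \<open>0 \<le> c\<close> by (intro mult_right_mono) (auto simp: power2_eq_square)
    ultimately show ?thesis by linarith
  qed
qed

text \<open>The growth bound counts mass from the origin on; one more block inequality moves it into
  a distant window. The 7 is a round bound for \<open>6 * (17/16)^2\<close>.\<close>

lemma solution_mass_lower_bound:
  assumes w: "solution l z w" and J: "1 \<le> J"
    and t: "\<And>i. 1 \<le> i \<Longrightarrow> i \<le> J \<Longrightarrow> (cmod (fib_trace (of_real l) z (2 * i + 2)))\<^sup>2 \<le> 5"
  shows "(17 / 16) ^ J / 7 * ((cmod (w 0))\<^sup>2 + (cmod (w 1))\<^sup>2)
     \<le> (\<Sum>n\<in>{fib (2 * J + 2)..<fib (2 * J + 4)}. (cmod (w n))\<^sup>2)"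
proof -
  define c where "c = (17 / 16) ^ J * ((cmod (w 0))\<^sup>2 + (cmod (w 1))\<^sup>2)"
  have "0 \<le> c" by (simp add: c_def)
  have "c / (17 / 16)\<^sup>2 \<le> (\<Sum>n<fib (2 * J + 1). (cmod (w n))\<^sup>2)"
    using solution_mass_growth[OF w t, of J J] J by (simp add: c_def)
  also have "\<dots> \<le> 6 * (\<Sum>n\<in>{fib (2 * J + 2)..<fib (2 * J + 4)}. (cmod (w n))\<^sup>2)"
    using solution_mass_block[OF w, of "2 * J + 2"] t[of J] J by (simp add: eval_nat_numeral)
  finally have "c / (6 * (17 / 16)\<^sup>2) \<le> (\<Sum>n\<in>{fib (2 * J + 2)..<fib (2 * J + 4)}. (cmod (w n))\<^sup>2)"
    by simp
  moreover have "c / 7 \<le> c / (6 * (17 / 16)\<^sup>2)"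
    using \<open>0 \<le> c\<close> by (intro divide_left_mono) (auto simp: power2_eq_square)
  ultimately show ?thesis by (simp add: c_def)
qed

section \<open>Wave amplitudes\<close>

definition ham_coeff :: "real \<Rightarrow> nat \<Rightarrow> int \<Rightarrow> complex" where
  "ham_coeff l k n = (fib_hamiltonian l ^^ k) (delta 0) $$ n"

text \<open>Coordinate \<open>n\<close> of the exponential of \<open>x * H\<close> applied to
  \<open>delta 0\<close>, as an entire function of \<open>x\<close>; termwise differentiation gives
  the Schroedinger equation.\<close>

definition amplitude :: "real \<Rightarrow> int \<Rightarrow> complex \<Rightarrow> complex" where
  "amplitude l n x = (\<Sum>k. ham_coeff l k n / fact k * x ^ k)"

definition wave :: "real \<Rightarrow> int \<Rightarrow> real \<Rightarrow> complex" where
  "wave l n t = amplitude l n (- \<i> * of_real t)"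

text \<open>Bounds \<open>H\<close> in the supremum norm with weight
  \<open>exp \<bar>n\<bar>\<close>: each of the two neighbours costs a factor \<open>exp 1\<close>,
  the potential at most \<open>\<bar>l\<bar>\<close>.\<close>

definition decay_rate :: "real \<Rightarrow> real" where
  "decay_rate l = 2 * exp 1 + \<bar>l\<bar>"

lemma decay_rate_pos: "decay_rate l > 0"
  by (simp add: decay_rate_def add_pos_nonneg)

lemma ham_coeff_0: "ham_coeff l 0 n = (if n = 0 then 1 else 0)"
  by (simp add: ham_coeff_def delta.rep_eq)

lemma ham_coeff_Suc:
  "ham_coeff l (Suc k) n =
    ham_coeff l k (n + 1) + ham_coeff l k (n - 1) + of_real (fib_potential l n) * ham_coeff l k n"
  by (simp add: ham_coeff_def fib_hamiltonian.rep_eq)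

lemma ham_coeff_bound: "cmod (ham_coeff l k n) \<le> exp (- real_of_int \<bar>n\<bar>) * decay_rate l ^ k"
proof (induction k arbitrary: n)
  case 0
  show ?case by (simp add: ham_coeff_0)
next
  case (Suc k)
  have nb: "cmod (ham_coeff l k m) \<le> exp 1 * exp (- real_of_int \<bar>n\<bar>) * decay_rate l ^ k"
    if "\<bar>n\<bar> \<le> \<bar>m\<bar> + 1" for m
  proof -
    have "exp (- real_of_int \<bar>m\<bar>) \<le> exp (1 - real_of_int \<bar>n\<bar>)"
      using that by simp
    also have "\<dots> = exp 1 * exp (- real_of_int \<bar>n\<bar>)" by (simp add: exp_add[symmetric])
    finally show ?thesis
      using Suc[of m] decay_rate_pos[of l] by (meson less_imp_le mult_right_mono order_trans zero_le_power)
  qed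
  have "cmod (ham_coeff l (Suc k) n) \<le> cmod (ham_coeff l k (n + 1)) + cmod (ham_coeff l k (n - 1))
      + cmod (of_real (fib_potential l n) * ham_coeff l k n)"
    unfolding ham_coeff_Suc by (intro order_trans[OF norm_triangle_ineq] add_mono norm_triangle_ineq order_refl)
  also have "\<dots> \<le> exp 1 * exp (- real_of_int \<bar>n\<bar>) * decay_rate l ^ k + exp 1 * exp (- real_of_int \<bar>n\<bar>) * decay_rate l ^ k
      + \<bar>l\<bar> * (exp (- real_of_int \<bar>n\<bar>) * decay_rate l ^ k)"
    unfolding norm_mult norm_of_real
    using fib_potential_bound Suc[of n] by (intro add_mono nb mult_mono) auto
  also have "\<dots> = exp (- real_of_int \<bar>n\<bar>) * decay_rate l ^ Suc k"
    by (simp add: decay_rate_def algebra_simps)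
  finally show ?case .
qed

lemma amplitude_summable:
  shows "summable (\<lambda>k. cmod (ham_coeff l k n / fact k * x ^ k))"
    and "(\<Sum>k. cmod (ham_coeff l k n / fact k * x ^ k)) \<le> exp (- real_of_int \<bar>n\<bar>) * exp (decay_rate l * cmod x)"
proof -
  have sums: "(\<lambda>k. exp (- real_of_int \<bar>n\<bar>) * ((decay_rate l * cmod x) ^ k /\<^sub>R fact k)) sums
      (exp (- real_of_int \<bar>n\<bar>) * exp (decay_rate l * cmod x))"
    by (intro sums_mult exp_converges)
  have le: "cmod (ham_coeff l k n / fact k * x ^ k) \<le> exp (- real_of_int \<bar>n\<bar>) * ((decay_rate l * cmod x) ^ k /\<^sub>R fact k)" for k
    using mult_right_mono[OF ham_coeff_bound[of l k n], of "cmod x ^ k / fact k"]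
    by (simp add: norm_mult norm_divide norm_power power_mult_distrib field_simps)
  show s: "summable (\<lambda>k. cmod (ham_coeff l k n / fact k * x ^ k))"
    by (rule summable_comparison_test'[OF sums_summable[OF sums], of 0]) (use le in auto)
  show "(\<Sum>k. cmod (ham_coeff l k n / fact k * x ^ k)) \<le> exp (- real_of_int \<bar>n\<bar>) * exp (decay_rate l * cmod x)"
    using suminf_le[OF le s sums_summable[OF sums]] sums_unique[OF sums] by simp
qed

lemma wave_bound: "cmod (wave l n t) \<le> exp (decay_rate l * \<bar>t\<bar> - real_of_int \<bar>n\<bar>)"
proof -
  have "cmod (wave l n t) \<le> exp (- real_of_int \<bar>n\<bar>) * exp (decay_rate l * cmod (- \<i> * of_real t))"
    unfolding wave_def amplitude_def
    using summable_norm[OF amplitude_summable(1)] amplitude_summable(2) order_trans by blast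
  then show ?thesis by (simp add: norm_mult exp_add[symmetric])
qed

lemma amplitude_deriv:
  "(amplitude l n has_field_derivative
     (amplitude l (n + 1) x + amplitude l (n - 1) x + of_real (fib_potential l n) * amplitude l n x)) (at x)"
proof -
  have s: "summable (\<lambda>k. ham_coeff l k m / fact k * y ^ k)" for m y
    by (rule summable_norm_cancel[OF amplitude_summable(1)])
  have dk: "diffs (\<lambda>k. ham_coeff l k n / fact k) k = ham_coeff l (Suc k) n / fact k" for k
    by (simp add: diffs_def field_simps del: of_nat_Suc)
  have "diffs (\<lambda>k. ham_coeff l k n / fact k) k * x ^ k
     = (ham_coeff l k (n + 1) / fact k * x ^ k + ham_coeff l k (n - 1) / fact k * x ^ k)
          + of_real (fib_potential l n) * (ham_coeff l k n / fact k * x ^ k)" for k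
    unfolding dk ham_coeff_Suc by (simp add: field_simps)
  then have "(\<Sum>k. diffs (\<lambda>k. ham_coeff l k n / fact k) k * x ^ k)
     = (\<Sum>k. (ham_coeff l k (n + 1) / fact k * x ^ k + ham_coeff l k (n - 1) / fact k * x ^ k)
          + of_real (fib_potential l n) * (ham_coeff l k n / fact k * x ^ k))"
    by (intro suminf_cong)
  also have "\<dots> = amplitude l (n + 1) x + amplitude l (n - 1) x + of_real (fib_potential l n) * amplitude l n x"
    unfolding amplitude_def
    by (subst suminf_add[symmetric] suminf_mult[symmetric]; (intro summable_add summable_mult s)?)+ (rule refl)
  finally show ?thesis
    using termdiffs_strong_converges_everywhere[OF s, of n x] unfolding amplitude_def by simp
qed

lemma wave_deriv:
  "((\<lambda>t. wave l n t) has_vector_derivative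
     (- \<i> * (wave l (n + 1) t + wave l (n - 1) t + of_real (fib_potential l n) * wave l n t))) (at t)"
proof -
  have "((\<lambda>t. - \<i> * of_real t) has_vector_derivative - \<i> * 1) (at t)"
    by (intro derivative_eq_intros has_vector_derivative_mult_right | simp)+
  from field_vector_diff_chain_at[OF this amplitude_deriv[of l n]]
  show ?thesis by (simp add: wave_def o_def)
qed

lemma continuous_on_wave: "continuous_on A (wave l n)"
  using wave_deriv[of l n] by (meson continuous_at_imp_continuous_on has_vector_derivative_continuous)

lemma wave_0: "wave l n 0 = (if n = 0 then 1 else 0)"
proof -
  have "(\<Sum>k. ham_coeff l k n / fact k * 0 ^ k) = ham_coeff l 0 n"
    using powser_zero[of "\<lambda>k. ham_coeff l k n / fact k"] by simp
  then show ?thesis by (simp add: wave_def amplitude_def ham_coeff_0)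
qed

lemma bounded_linear_nth: "bounded_linear (\<lambda>u. u $$ n)"
  by (rule bounded_linear_intro[where K = 1])
    (auto simp: plus_ell2.rep_eq scaleR_ell2.rep_eq cmod_nth_le_norm)

lemma fib_hamiltonian_scaleC: "fib_hamiltonian l (c *\<^sub>C u) = c *\<^sub>C fib_hamiltonian l u"
  by (rule ell2_eqI) (simp add: fib_hamiltonian.rep_eq scaleC.rep_eq algebra_simps)

lemma evolution_nth: "evolution (fib_hamiltonian l) t (delta 0) $$ n = wave l n t"
proof -
  define A where "A = (\<lambda>u. (- \<i> * complex_of_real t) *\<^sub>C fib_hamiltonian l u)"
  have pow: "(A ^^ k) (delta 0) = (- \<i> * of_real t) ^ k *\<^sub>C (fib_hamiltonian l ^^ k) (delta 0)" for k
    by (induction k) (auto simp: A_def fib_hamiltonian_scaleC scaleC.rep_eq intro!: ell2_eqI)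
  have "summable (\<lambda>k. (1 / fact k) *\<^sub>R (A ^^ k) (delta 0))"
    unfolding A_def by (rule evolution_summable[OF bounded_linear_fib_hamiltonian])
  then have "(\<Sum>k. ((1 / fact k) *\<^sub>R (A ^^ k) (delta 0)) $$ n) = op_exp A (delta 0) $$ n"
    unfolding op_exp_def by (rule bounded_linear.suminf[OF bounded_linear_nth, symmetric])
  moreover have "((1 / fact k) *\<^sub>R (A ^^ k) (delta 0)) $$ n = ham_coeff l k n / fact k * (- \<i> * of_real t) ^ k" for k
    by (simp add: pow scaleR_ell2.rep_eq scaleC.rep_eq ham_coeff_def scaleR_conv_of_real field_simps)
  ultimately show ?thesis
    by (simp add: evolution_def A_def wave_def amplitude_def)
qed

section \<open>Conservation of probability\<close>

lemma has_real_derivative_cmod_sq: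
  assumes "(f has_vector_derivative f') (at t)"
  shows "((\<lambda>t. (cmod (f t))\<^sup>2) has_real_derivative 2 * Re (cnj (f t) * f')) (at t)"
proof -
  have "((\<lambda>t. Re (f t)) has_real_derivative Re f') (at t)" "((\<lambda>t. Im (f t)) has_real_derivative Im f') (at t)"
    unfolding has_real_derivative_iff_has_vector_derivative
    by (intro bounded_linear.has_vector_derivative[OF bounded_linear_Re] bounded_linear.has_vector_derivative[OF bounded_linear_Im] assms)+
  from DERIV_add[OF DERIV_power[OF this(1), of 2] DERIV_power[OF this(2), of 2]]
  have "((\<lambda>t. (Re (f t))\<^sup>2 + (Im (f t))\<^sup>2) has_real_derivative 2 * Re (cnj (f t) * f')) (at t)"
    by (simp add: algebra_simps)
  then show ?thesis by (simp add: cmod_power2)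
qed

lemma symmetric_interval_Suc:
  "{- int (Suc N)..int (Suc N)} = insert (- int N - 1) (insert (int N + 1) {- int N..int N})"
  by auto

lemma sum_symmetric_telescope:
  fixes f :: "int \<Rightarrow> real"
  shows "(\<Sum>n\<in>{- int N..int N}. f n - f (n - 1)) = f (int N) - f (- int N - 1)"
proof (induction N)
  case (Suc N)
  have eq: "- 2 - int N = - int (Suc N) - 1" "int N + 1 = int (Suc N)" by simp_all
  from Suc show ?case by (simp add: symmetric_interval_Suc del: of_nat_Suc) (simp only: eq)
qed simp

text \<open>The derivative of the mass in a finite interval telescopes to the probability currents
  through its two ends, which are of order \<open>exp (- real N)\<close>. This replaces an appeal to
  unitarity.\<close>

lemma wave_mass_interval:
  assumes t: "t \<ge> 0"
  shows "(\<Sum>n\<in>{- int N..int N}. (cmod (wave l n t))\<^sup>2) \<le> 1 + 4 * t * exp (2 * decay_rate l * t) * exp (- real N)"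
proof (cases "t = 0")
  case True
  have "(cmod (wave l n 0))\<^sup>2 = (if n = 0 then 1 else 0)" for n by (simp add: wave_0)
  then show ?thesis using True by simp
next
  case False
  define M where "M s = (\<Sum>n\<in>{- int N..int N}. (cmod (wave l n s))\<^sup>2)" for s
  define f where "f s n = Im (cnj (wave l n s) * wave l (n + 1) s)" for s n
  have der: "(M has_real_derivative 2 * (f s (int N) - f s (- int N - 1))) (at s)" for s
  proof -
    have "(M has_real_derivative (\<Sum>n\<in>{- int N..int N}. 2 * Re (cnj (wave l n s) *
        (- \<i> * (wave l (n + 1) s + wave l (n - 1) s + of_real (fib_potential l n) * wave l n s))))) (at s)"
      unfolding M_def by (intro DERIV_sum has_real_derivative_cmod_sq wave_deriv)
    also have "(\<lambda>n. 2 * Re (cnj (wave l n s) *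
        (- \<i> * (wave l (n + 1) s + wave l (n - 1) s + of_real (fib_potential l n) * wave l n s))))
        = (\<lambda>n. 2 * (f s n - f s (n - 1)))"
      by (rule ext) (simp add: f_def algebra_simps)
    finally show ?thesis
      by (simp only: sum_distrib_left[symmetric] sum_symmetric_telescope)
  qed
  have fb: "\<bar>f s n\<bar> \<le> exp (2 * decay_rate l * t) * exp (- real N)"
    if "0 \<le> s" "s \<le> t" "n = int N \<or> n = - int N - 1" for s n
  proof -
    have "\<bar>f s n\<bar> \<le> cmod (wave l n s) * cmod (wave l (n + 1) s)"
      unfolding f_def by (metis abs_Im_le_cmod complex_mod_cnj norm_mult)
    also have "\<dots> \<le> exp (decay_rate l * \<bar>s\<bar> - real_of_int \<bar>n\<bar>) * exp (decay_rate l * \<bar>s\<bar> - real_of_int \<bar>n + 1\<bar>)"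
      by (intro mult_mono wave_bound) auto
    also have "\<dots> = exp (2 * (decay_rate l * s) - real_of_int \<bar>n\<bar> - real_of_int \<bar>n + 1\<bar>)"
      using that by (simp add: exp_add[symmetric] algebra_simps)
    also have "\<dots> \<le> exp (2 * (decay_rate l * t) - real N)"
    proof -
      have "decay_rate l * s \<le> decay_rate l * t" using that decay_rate_pos[of l] by simp
      moreover have "real N \<le> real_of_int \<bar>n\<bar> + real_of_int \<bar>n + 1\<bar>" using that(3) by auto
      ultimately show ?thesis by simp
    qed
    finally show ?thesis by (simp add: exp_add[symmetric] mult.assoc)
  qed
  obtain s where s: "0 < s" "s < t" "M t - M 0 = t * (2 * (f s (int N) - f s (- int N - 1)))"
    using MVT2[of 0 t M "\<lambda>s. 2 * (f s (int N) - f s (- int N - 1))"] der t False by auto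
  have "f s (int N) - f s (- int N - 1) \<le> 2 * (exp (2 * decay_rate l * t) * exp (- real N))"
    using fb[of s "int N"] fb[of s "- int N - 1"] s by auto
  then have "t * (2 * (f s (int N) - f s (- int N - 1))) \<le> t * (2 * (2 * (exp (2 * decay_rate l * t) * exp (- real N))))"
    using t by (intro mult_left_mono) auto
  moreover have "(cmod (wave l n 0))\<^sup>2 = (if n = 0 then 1 else 0)" for n by (simp add: wave_0)
  then have "M 0 = 1" by (simp add: M_def)
  ultimately have "M t \<le> 1 + t * (2 * (2 * (exp (2 * decay_rate l * t) * exp (- real N))))"
    using s(3) by linarith
  then show ?thesis unfolding M_def by (simp add: mult_ac)
qed

lemma finite_subset_symmetric_interval:
  assumes "finite (F :: int set)"
  obtains N0 where "\<And>N. N \<ge> N0 \<Longrightarrow> F \<subseteq> {- int N..int N}"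
proof
  fix N assume N: "N \<ge> nat (\<Sum>n\<in>F. \<bar>n\<bar>)"
  show "F \<subseteq> {- int N..int N}"
  proof
    fix n assume "n \<in> F"
    then have "\<bar>n\<bar> \<le> (\<Sum>n\<in>F. \<bar>n\<bar>)" using assms by (intro member_le_sum) auto
    then show "n \<in> {- int N..int N}" using N by auto
  qed
qed

lemma wave_mass_le_1:
  assumes "t \<ge> 0" "finite F"
  shows "(\<Sum>n\<in>F. (cmod (wave l n t))\<^sup>2) \<le> 1"
proof (rule tendsto_lowerbound)
  have "((\<lambda>N. 1 + 4 * t * exp (2 * decay_rate l * t) * exp (- real N)) \<longlonglongrightarrow> 1 + 4 * t * exp (2 * decay_rate l * t) * 0)"
    by (intro tendsto_intros filterlim_compose[OF exp_at_bot] filterlim_compose[OF filterlim_uminus_at_bot_at_top]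
        filterlim_real_sequentially)
  then show "((\<lambda>N. 1 + 4 * t * exp (2 * decay_rate l * t) * exp (- real N)) \<longlonglongrightarrow> 1)" by simp
  obtain N0 where N0: "\<And>N. N \<ge> N0 \<Longrightarrow> F \<subseteq> {- int N..int N}"
    using finite_subset_symmetric_interval[OF assms(2)] by blast
  have "(\<Sum>n\<in>F. (cmod (wave l n t))\<^sup>2) \<le> 1 + 4 * t * exp (2 * decay_rate l * t) * exp (- real N)" if "N \<ge> N0" for N
    by (rule order_trans[OF sum_mono2 wave_mass_interval[OF assms(1)]]) (use N0[OF that] in auto)
  then show "\<forall>\<^sub>F N in sequentially. (\<Sum>n\<in>F. (cmod (wave l n t))\<^sup>2) \<le> 1 + 4 * t * exp (2 * decay_rate l * t) * exp (- real N)"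
    unfolding eventually_sequentially by blast
qed simp

lemma wave_le_1: "t \<ge> 0 \<Longrightarrow> cmod (wave l n t) \<le> 1"
  using wave_mass_le_1[of t "{n}" l] by (simp add: abs_square_le_1)

section \<open>Moments and the resolvent\<close>

lemma powr_le_exp:
  fixes x p s :: real
  assumes "x \<ge> 0" "p > 0" "s > 0"
  shows "x powr p \<le> (p / s) powr p * exp (s * x)"
proof -
  have "s * x / p \<le> exp (s * x / p)" using exp_ge_add_one_self[of "s * x / p"] by linarith
  then have "x \<le> (p / s) * exp (s * x / p)" using assms by (simp add: field_simps)
  then have "x powr p \<le> ((p / s) * exp (s * x / p)) powr p"
    using assms by (intro powr_mono2) auto
  also have "\<dots> = (p / s) powr p * exp (s * x)"
    using assms by (subst powr_mult) (auto simp: powr_def[of "exp _"])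
  finally show ?thesis .
qed

lemma sum_exp_abs_bound:
  fixes F :: "int set"
  assumes "finite F"
  shows "(\<Sum>n\<in>F. exp (- real_of_int \<bar>n\<bar> / 2)) \<le> 2 / (1 - exp (- 1 / 2))"
proof -
  define q :: real where "q = exp (- 1 / 2)"
  have q: "0 < q" "q < 1" by (simp_all add: q_def)
  obtain N where N: "F \<subseteq> {- int N..int N}"
  proof (rule finite_subset_symmetric_interval[OF assms])
    fix N0 assume "\<And>N. N0 \<le> N \<Longrightarrow> F \<subseteq> {- int N..int N}"
    then show thesis using that[of N0] by simp
  qed
  have qp: "exp (- real_of_int \<bar>n\<bar> / 2) = q ^ nat \<bar>n\<bar>" for n
    unfolding q_def exp_of_nat_mult[symmetric] by simp
  have "(\<Sum>n\<in>F. q ^ nat \<bar>n\<bar>) \<le> (\<Sum>n\<in>{- int N..int N}. q ^ nat \<bar>n\<bar>)"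
    using N q by (intro sum_mono2) auto
  also have "\<dots> \<le> 2 * (\<Sum>k<Suc N. q ^ k)"
  proof (induction N)
    case (Suc N)
    have "nat \<bar>- int N - 1\<bar> = Suc N" "nat \<bar>int N + 1\<bar> = Suc N" by linarith+
    then show ?case using Suc by (simp add: symmetric_interval_Suc del: of_nat_Suc power_Suc)
  qed simp
  also have "(\<Sum>k<Suc N. q ^ k) \<le> 1 / (1 - q)"
    using sum_le_suminf[OF summable_geometric[of q], of "{..<Suc N}"] suminf_geometric[of q] q by simp
  finally show ?thesis unfolding qp by (simp add: q_def)
qed

definition moment_term :: "real \<Rightarrow> real \<Rightarrow> int \<Rightarrow> real \<Rightarrow> real" where
  "moment_term l p n t = real_of_int \<bar>n\<bar> powr p * (cmod (wave l n t))\<^sup>2"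

lemma moment_term_nonneg: "0 \<le> moment_term l p n t"
  by (simp add: moment_term_def)

lemma moment_eq: "moment (fib_hamiltonian l) (delta 0) p t = (\<Sum>\<^sub>\<infinity>n. moment_term l p n t)"
  by (simp add: moment_def moment_term_def cinner_delta evolution_nth)

text \<open>
  Inside the ballistic range \<open>\<bar>n\<bar> \<le> 2 * decay_rate l * t\<close> the total mass is at most 1; outside it
  the amplitudes decay exponentially.
\<close>

lemma moment_sum_bound:
  assumes p: "p > 0"
  obtains D where "D \<ge> 0" "\<And>F t. finite F \<Longrightarrow> t \<ge> 0 \<Longrightarrow>
     (\<Sum>n\<in>F. moment_term l p n t) \<le> (2 * decay_rate l * t) powr p + D"
proof
  \<comment> \<open>The constant of \<open>powr_le_exp\<close> at rate 1/2: half of the decay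
    outside the ballistic range absorbs the power, the other half stays summable.\<close>
  define C where "C = (p / (1 / 2)) powr p"
  define D where "D = C * (2 / (1 - exp (- 1 / 2)))"
  show "D \<ge> 0" by (simp add: D_def C_def)
  fix F :: "int set" and t :: real assume F: "finite F" and t: "t \<ge> 0"
  have pointwise: "moment_term l p n t \<le> (2 * decay_rate l * t) powr p * (cmod (wave l n t))\<^sup>2 + C * exp (- real_of_int \<bar>n\<bar> / 2)" for n
  proof (cases "real_of_int \<bar>n\<bar> \<le> 2 * decay_rate l * t")
    case True
    then have "real_of_int \<bar>n\<bar> powr p \<le> (2 * decay_rate l * t) powr p" using p by (intro powr_mono2) auto
    then have "moment_term l p n t \<le> (2 * decay_rate l * t) powr p * (cmod (wave l n t))\<^sup>2"
      unfolding moment_term_def by (intro mult_right_mono) auto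
    moreover have "0 \<le> C * exp (- real_of_int \<bar>n\<bar> / 2)" by (simp add: C_def)
    ultimately show ?thesis by linarith
  next
    case False
    have "(cmod (wave l n t))\<^sup>2 \<le> (exp (decay_rate l * \<bar>t\<bar> - real_of_int \<bar>n\<bar>))\<^sup>2"
      by (intro power_mono wave_bound) auto
    also have "\<dots> = exp (2 * decay_rate l * t - 2 * real_of_int \<bar>n\<bar>)"
      using t by (simp add: power2_eq_square exp_add[symmetric] algebra_simps)
    also have "\<dots> \<le> exp (- real_of_int \<bar>n\<bar>)" using False by simp
    finally have "moment_term l p n t \<le> (C * exp (1 / 2 * real_of_int \<bar>n\<bar>)) * exp (- real_of_int \<bar>n\<bar>)"
      unfolding moment_term_def C_def using p by (intro mult_mono powr_le_exp) auto
    also have "\<dots> = C * exp (- real_of_int \<bar>n\<bar> / 2)"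
      by (simp add: mult.assoc exp_add[symmetric])
    finally have "moment_term l p n t \<le> C * exp (- real_of_int \<bar>n\<bar> / 2)" .
    moreover have "0 \<le> (2 * decay_rate l * t) powr p * (cmod (wave l n t))\<^sup>2" by simp
    ultimately show ?thesis by linarith
  qed
  have "(\<Sum>n\<in>F. moment_term l p n t) \<le> (\<Sum>n\<in>F. (2 * decay_rate l * t) powr p * (cmod (wave l n t))\<^sup>2 + C * exp (- real_of_int \<bar>n\<bar> / 2))"
    by (intro sum_mono pointwise)
  also have "\<dots> = (2 * decay_rate l * t) powr p * (\<Sum>n\<in>F. (cmod (wave l n t))\<^sup>2) + C * (\<Sum>n\<in>F. exp (- real_of_int \<bar>n\<bar> / 2))"
    by (simp add: sum.distrib sum_distrib_left)
  also have "\<dots> \<le> (2 * decay_rate l * t) powr p * 1 + C * (2 / (1 - exp (- 1 / 2)))"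
    by (intro add_mono mult_left_mono wave_mass_le_1 sum_exp_abs_bound F t) (auto simp: C_def)
  finally show "(\<Sum>n\<in>F. moment_term l p n t) \<le> (2 * decay_rate l * t) powr p + D"
    by (simp add: D_def)
qed

text \<open>An \<open>infsum\<close> without convergence is 0 by convention, so bounding the moment
  below by finite sums depends on this.\<close>

lemma moment_term_summable:
  assumes "p > 0" "t \<ge> 0"
  shows "(\<lambda>n. moment_term l p n t) summable_on UNIV"
proof -
  obtain D where "\<And>F. finite F \<Longrightarrow> (\<Sum>n\<in>F. moment_term l p n t) \<le> (2 * decay_rate l * t) powr p + D"
    using moment_sum_bound[OF assms(1), of l] assms(2) by metis
  then show ?thesis
    by (intro nonneg_bdd_above_summable_on moment_term_nonneg)
      (auto intro!: bdd_aboveI[of _ "(2 * decay_rate l * t) powr p + D"])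
qed

lemma sum_le_moment:
  assumes "p > 0" "t \<ge> 0" "finite F"
  shows "(\<Sum>n\<in>F. moment_term l p n t) \<le> moment (fib_hamiltonian l) (delta 0) p t"
  unfolding moment_eq
  using moment_term_summable[OF assms(1,2)] assms(3) moment_term_nonneg by (intro finite_sum_le_infsum) auto

lemma moment_bound:
  assumes "p > 0"
  obtains D where "D \<ge> 0" "\<And>t. t \<ge> 0 \<Longrightarrow> moment (fib_hamiltonian l) (delta 0) p t \<le> (2 * decay_rate l * t) powr p + D"
proof -
  obtain D where D: "D \<ge> 0" "\<And>F t. finite F \<Longrightarrow> t \<ge> 0 \<Longrightarrow>
     (\<Sum>n\<in>F. moment_term l p n t) \<le> (2 * decay_rate l * t) powr p + D"
    using moment_sum_bound[OF assms, of l] by blast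
  show ?thesis
    by (rule that[OF D(1)], unfold moment_eq)
      (use D(2) moment_term_summable[OF assms] in \<open>auto intro: infsum_le_finite_sums\<close>)
qed

lemma continuous_on_moment_term: "continuous_on A (moment_term l p n)"
  unfolding moment_term_def by (intro continuous_intros continuous_on_wave)

lemma filterlim_symmetric_intervals:
  "filterlim (\<lambda>N. {- int N..int N}) (finite_subsets_at_top UNIV) sequentially"
  unfolding filterlim_finite_subsets_at_top eventually_sequentially
  by (metis finite_atLeastAtMost_int finite_subset_symmetric_interval subset_UNIV)

text \<open>For \<open>t > 0\<close> the moment is a pointwise limit of continuous partial
  sums.\<close>

lemma moment_borel_measurable:
  assumes "p > 0"
  shows "(\<lambda>t. indicator {0<..} t *\<^sub>R moment (fib_hamiltonian l) (delta 0) p t) \<in> borel_measurable lborel"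
proof (rule borel_measurable_LIMSEQ_real)
  show "(\<lambda>t. indicator {0<..} t *\<^sub>R (\<Sum>n\<in>{- int N..int N}. moment_term l p n t)) \<in> borel_measurable lborel" for N
  proof -
    have "moment_term l p n \<in> borel_measurable borel" for n
      by (rule borel_measurable_continuous_onI[OF continuous_on_moment_term])
    then show ?thesis by simp measurable
  qed
  fix t :: real
  show "(\<lambda>N. indicator {0<..} t *\<^sub>R (\<Sum>n\<in>{- int N..int N}. moment_term l p n t))
     \<longlonglongrightarrow> indicator {0<..} t *\<^sub>R moment (fib_hamiltonian l) (delta 0) p t"
  proof (cases "t > 0")
    case True
    have "((\<lambda>n. moment_term l p n t) has_sum moment (fib_hamiltonian l) (delta 0) p t) UNIV"
      unfolding moment_eq using moment_term_summable[OF assms, of t l] True by (intro has_sum_infsum) auto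
    then have "(\<lambda>N. \<Sum>n\<in>{- int N..int N}. moment_term l p n t) \<longlonglongrightarrow> moment (fib_hamiltonian l) (delta 0) p t"
      unfolding has_sum_def by (rule filterlim_compose[OF _ filterlim_symmetric_intervals])
    then show ?thesis using True by simp
  qed simp
qed

section \<open>Integrability in time\<close>

lemma exp_decay_integral:
  fixes e :: real
  assumes e: "e > 0"
  shows "set_integrable lborel {0<..} (\<lambda>t. exp (- (e * t)))"
    and "(LINT t:{0<..}|lborel. exp (- (e * t))) = 1 / e"
proof -
  define F where "F t = - exp (- (e * t)) / e" for t
  have 1: "(F \<longlongrightarrow> F 0) (at_right 0)"
  proof -
    have "isCont F 0" unfolding F_def using e by (intro continuous_intros) auto
    then show ?thesis by (simp add: isCont_def filterlim_at_split)
  qed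
  have "((\<lambda>t. - exp (- (e * t)) / e) \<longlongrightarrow> - 0 / e) at_top"
    using e by (intro tendsto_intros filterlim_compose[OF exp_at_bot] filterlim_compose[OF filterlim_uminus_at_bot_at_top]
       filterlim_tendsto_pos_mult_at_top[OF tendsto_const] filterlim_ident) auto
  then have 2: "(F \<longlongrightarrow> 0) at_top" by (simp add: F_def[abs_def])
  have d: "DERIV F x :> exp (- (e * x))" for x
    unfolding F_def using e by (auto intro!: derivative_eq_intros)
  have c: "isCont (\<lambda>t. exp (- (e * t))) x" for x by (intro continuous_intros)
  note FTC = interval_integral_FTC_nonneg[of 0 \<infinity> F "\<lambda>t. exp (- (e * t))" "F 0" 0]
  have z: "(0 :: ereal) = ereal 0" by (simp add: zero_ereal_def)
  show "set_integrable lborel {0<..} (\<lambda>t. exp (- (e * t)))"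
    using FTC(1) d c 1 2 unfolding z by (simp add: ereal_tendsto_simps1 del: zero_ereal_def)
  show "(LINT t:{0<..}|lborel. exp (- (e * t))) = 1 / e"
    using FTC(2) d c 1 2 unfolding z
    by (simp add: ereal_tendsto_simps1 interval_lebesgue_integral_def F_def del: zero_ereal_def)
qed

text \<open>A non-integrable function has integral 0 by convention, so a lower bound on
  \<open>time_average\<close> depends on this. Half of the exponential weight absorbs the polynomial
  growth of the moment.\<close>

lemma moment_integrable:
  assumes p: "p > 0" and e: "e > 0"
  shows "set_integrable lborel {0<..} (\<lambda>t. exp (- (e * t)) * moment (fib_hamiltonian l) (delta 0) p t)"
proof -
  define M where "M = moment (fib_hamiltonian l) (delta 0) p"
  obtain D where D: "D \<ge> 0" "\<And>t. t \<ge> 0 \<Longrightarrow> M t \<le> (2 * decay_rate l * t) powr p + D"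
    using moment_bound[OF p, of l] unfolding M_def by blast
  define K where "K = 2 * decay_rate l"
  have K: "K > 0" using decay_rate_pos[of l] by (simp add: K_def)
  define s where "s = e / (2 * K)"
  have s: "s > 0" "s * K = e / 2" using e K by (simp_all add: s_def)
  define C where "C = (p / s) powr p + D"
  have "exp (- (e * t)) * M t \<le> C * exp (- (e / 2 * t))" if t: "t > 0" for t
  proof -
    have "K * t \<ge> 0" using t K by simp
    then have "(K * t) powr p \<le> (p / s) powr p * exp (s * (K * t))" using s p by (intro powr_le_exp) auto
    also have "s * (K * t) = e / 2 * t" using s(2) by (simp add: mult.assoc[symmetric])
    finally have "M t \<le> (p / s) powr p * exp (e / 2 * t) + D * exp (e / 2 * t)"
      using D(2)[of t] t e D(1) mult_left_mono[of 1 "exp (e / 2 * t)" D] unfolding K_def by simp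
    then have "exp (- (e * t)) * M t \<le> exp (- (e * t)) * (C * exp (e / 2 * t))"
      by (intro mult_left_mono) (auto simp: C_def algebra_simps)
    also have "\<dots> = C * (exp (- (e * t)) * exp (e / 2 * t))" by (simp add: mult_ac)
    also have "exp (- (e * t)) * exp (e / 2 * t) = exp (- (e / 2 * t))" by (simp add: exp_add[symmetric])
    finally show ?thesis .
  qed
  moreover have "0 \<le> M t" for t unfolding M_def moment_eq by (intro infsum_nonneg moment_term_nonneg)
  ultimately have bd: "\<bar>exp (- (e * t)) * M t\<bar> \<le> \<bar>C * exp (- (e / 2 * t))\<bar>" if "t > 0" for t
    using that by (metis abs_ge_self abs_of_nonneg exp_ge_zero mult_nonneg_nonneg order_trans)
  have int: "set_integrable lborel {0<..} (\<lambda>t. C * exp (- (e / 2 * t)))"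
    using e by (intro set_integrable_mult_right exp_decay_integral(1)) auto
  have "(\<lambda>t. exp (- (e * t)) * (indicator {0<..} t *\<^sub>R M t)) \<in> borel_measurable lborel"
    using moment_borel_measurable[OF p, of l] unfolding M_def by measurable
  then have meas: "set_borel_measurable lborel {0<..} (\<lambda>t. exp (- (e * t)) * M t)"
    unfolding set_borel_measurable_def by (simp add: mult_ac)
  show ?thesis
    unfolding M_def[symmetric]
    by (rule set_integrable_bound[OF int meas]) (use bd in auto)
qed

lemma wave_weighted_integrable:
  assumes e: "Im z > 0"
  shows "set_integrable lborel {0<..} (\<lambda>t. exp (\<i> * z * of_real t) * wave l n t)"
    and "set_integrable lborel {0<..} (\<lambda>t. exp (- (Im z * t)) * cmod (wave l n t))"
    and "set_integrable lborel {0<..} (\<lambda>t. exp (- (Im z * t)) * (cmod (wave l n t))\<^sup>2)"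
proof -
  have [measurable]: "wave l n \<in> borel_measurable borel"
    by (rule borel_measurable_continuous_onI[OF continuous_on_wave])
  have [measurable]: "(\<lambda>t. exp (\<i> * z * of_real t)) \<in> borel_measurable borel"
    by (intro borel_measurable_continuous_onI continuous_intros)
  note int = exp_decay_integral(1)[OF e]
  note w1 = wave_le_1[of _ l n]
  show "set_integrable lborel {0<..} (\<lambda>t. exp (\<i> * z * of_real t) * wave l n t)"
  proof (rule set_integrable_bound[OF int])
    show "set_borel_measurable lborel {0<..} (\<lambda>t. exp (\<i> * z * of_real t) * wave l n t)"
      unfolding set_borel_measurable_def by measurable
    have "norm (exp (\<i> * z * of_real t) * wave l n t) \<le> norm (exp (- (Im z * t)))" if "t > 0" for t
      using w1[of t] that by (simp add: norm_mult norm_exp_eq_Re mult_left_le)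
    then show "AE t in lborel. t \<in> {0<..} \<longrightarrow> norm (exp (\<i> * z * of_real t) * wave l n t) \<le> norm (exp (- (Im z * t)))"
      by auto
  qed
  show "set_integrable lborel {0<..} (\<lambda>t. exp (- (Im z * t)) * cmod (wave l n t))"
  proof (rule set_integrable_bound[OF int])
    show "set_borel_measurable lborel {0<..} (\<lambda>t. exp (- (Im z * t)) * cmod (wave l n t))"
      unfolding set_borel_measurable_def by measurable
    have "norm (exp (- (Im z * t)) * cmod (wave l n t)) \<le> norm (exp (- (Im z * t)))" if "t > 0" for t
      using w1[of t] that by (simp add: mult_left_le)
    then show "AE t in lborel. t \<in> {0<..} \<longrightarrow> norm (exp (- (Im z * t)) * cmod (wave l n t)) \<le> norm (exp (- (Im z * t)))"
      by auto
  qed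
  show "set_integrable lborel {0<..} (\<lambda>t. exp (- (Im z * t)) * (cmod (wave l n t))\<^sup>2)"
  proof (rule set_integrable_bound[OF int])
    show "set_borel_measurable lborel {0<..} (\<lambda>t. exp (- (Im z * t)) * (cmod (wave l n t))\<^sup>2)"
      unfolding set_borel_measurable_def by measurable
    have "norm (exp (- (Im z * t)) * (cmod (wave l n t))\<^sup>2) \<le> norm (exp (- (Im z * t)))" if "t > 0" for t
      using w1[of t] that by (simp add: mult_left_le power_le_one)
    then show "AE t in lborel. t \<in> {0<..} \<longrightarrow> norm (exp (- (Im z * t)) * (cmod (wave l n t))\<^sup>2) \<le> norm (exp (- (Im z * t)))"
      by auto
  qed
qed

text \<open>The Green function from site 0 to site \<open>n\<close> for \<open>Im z > 0\<close>,
  taken directly as a Laplace transform of the wave.\<close>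

definition resolvent :: "real \<Rightarrow> complex \<Rightarrow> int \<Rightarrow> complex" where
  "resolvent l z n = \<i> * (LINT t:{0<..}|lborel. exp (\<i> * z * of_real t) * wave l n t)"

text \<open>Integrate the time derivative of the weighted wave over \<open>t > 0\<close>. The
  Schroedinger equation turns it into the difference operator; the boundary term at infinity
  vanishes, and the one at time 0 is the initial state, which becomes the source.\<close>

lemma resolvent_equation:
  assumes z: "Im z > 0"
  shows "resolvent l z (n + 1) + resolvent l z (n - 1) + (of_real (fib_potential l n) - z) * resolvent l z n
     = (if n = 0 then 1 else 0)"
proof -
  define G where "G m t = exp (\<i> * z * of_real t) * wave l m t" for m t
  define v where "v = complex_of_real (fib_potential l n) - z"
  have int: "set_integrable lborel {0<..} (G m)" for m
    using wave_weighted_integrable(1)[OF z] by (simp add: G_def[abs_def])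
  have cG: "isCont (G m) t" for m t
    unfolding G_def using continuous_on_wave[of UNIV l m]
    by (intro continuous_intros) (simp add: continuous_on_eq_continuous_at)
  define g where "g t = - \<i> * (G (n + 1) t + G (n - 1) t + v * G n t)" for t
  have der: "(G n has_vector_derivative g t) (at t)" for t
  proof -
    have "((\<lambda>t. exp (\<i> * z * of_real t)) has_vector_derivative \<i> * z * exp (\<i> * z * of_real t)) (at t)"
    proof -
      have "((\<lambda>t. \<i> * z * of_real t) has_vector_derivative \<i> * z * 1) (at t)"
        by (intro derivative_eq_intros has_vector_derivative_mult_right | simp)+
      from field_vector_diff_chain_at[OF this DERIV_exp] show ?thesis by (simp add: o_def)
    qed
    from has_vector_derivative_mult[OF this wave_deriv[of l n t]]
    show ?thesis unfolding G_def g_def v_def by (simp add: algebra_simps)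
  qed
  have gint: "set_integrable lborel {0<..} g"
    unfolding g_def by (intro set_integrable_mult_right set_integral_add(1) int)
  have 0: "(G n \<longlongrightarrow> G n 0) (at_right 0)"
    using cG[where m = n and t = 0] by (simp add: isCont_def filterlim_at_split)
  have "((\<lambda>t. exp (- (Im z * t))) \<longlongrightarrow> 0) at_top"
    using z by (intro filterlim_compose[OF exp_at_bot] filterlim_compose[OF filterlim_uminus_at_bot_at_top]
       filterlim_tendsto_pos_mult_at_top[OF tendsto_const] filterlim_ident) auto
  then have inf: "(G n \<longlongrightarrow> 0) at_top"
  proof (rule Lim_null_comparison[rotated])
    have "norm (G n t) \<le> exp (- (Im z * t))" if "t \<ge> 0" for t
      unfolding G_def using wave_le_1[OF that, of l n] by (simp add: norm_mult norm_exp_eq_Re mult_left_le)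
    then show "\<forall>\<^sub>F t in at_top. norm (G n t) \<le> exp (- (Im z * t))"
      unfolding eventually_at_top_linorder by blast
  qed
  have zero: "(0 :: ereal) = ereal 0" by (simp add: zero_ereal_def)
  have "(LBINT t=0..\<infinity>. g t) = 0 - G n 0"
  proof (rule interval_integral_FTC_integrable[where F = "G n"])
    show "isCont g t" for t unfolding g_def by (intro continuous_intros cG)
    show "set_integrable lborel (einterval 0 \<infinity>) g" using gint by (simp add: zero)
    show "((G n \<circ> real_of_ereal) \<longlongrightarrow> G n 0) (at_right 0)" unfolding zero ereal_tendsto_simps1 by (rule 0)
    show "((G n \<circ> real_of_ereal) \<longlongrightarrow> 0) (at_left \<infinity>)" unfolding ereal_tendsto_simps1 by (rule inf)
  qed (auto intro: der)
  then have eq: "(LINT t:{0<..}|lborel. g t) = - (if n = 0 then 1 else 0)"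
    by (simp add: interval_lebesgue_integral_def zero G_def wave_0)
  have "(LINT t:{0<..}|lborel. g t) =
     - (resolvent l z (n + 1) + resolvent l z (n - 1) + v * resolvent l z n)"
  proof -
    have "(LINT t:{0<..}|lborel. g t) = - \<i> * (LINT t:{0<..}|lborel. G (n + 1) t + G (n - 1) t + v * G n t)"
      unfolding g_def by (rule set_integral_mult_right)
    also have "(LINT t:{0<..}|lborel. G (n + 1) t + G (n - 1) t + v * G n t) =
        (LINT t:{0<..}|lborel. G (n + 1) t) + (LINT t:{0<..}|lborel. G (n - 1) t) + v * (LINT t:{0<..}|lborel. G n t)"
      by (simp only: set_integral_add(2)[OF set_integral_add(1)[OF int int] set_integrable_mult_right[OF int]]
          set_integral_add(2)[OF int int] set_integral_mult_right)
    finally show ?thesis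
      unfolding resolvent_def G_def[symmetric] by (simp add: algebra_simps)
  qed
  from eq[unfolded this neg_equal_iff_equal] show ?thesis unfolding v_def .
qed

text \<open>Cauchy--Schwarz at a single energy; it replaces the Plancherel identity.\<close>

lemma resolvent_sq_le:
  assumes z: "Im z > 0"
  shows "Im z * (cmod (resolvent l z n))\<^sup>2 \<le> (LINT t:{0<..}|lborel. exp (- (Im z * t)) * (cmod (wave l n t))\<^sup>2)"
proof -
  define e where "e = Im z"
  define A where "A = (LINT t:{0<..}|lborel. exp (- (e * t)) * cmod (wave l n t))"
  define Q where "Q = (LINT t:{0<..}|lborel. exp (- (e * t)) * (cmod (wave l n t))\<^sup>2)"
  have e: "e > 0" using z by (simp add: e_def)
  note int = wave_weighted_integrable[OF z, of l n, folded e_def]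
  have "cmod (resolvent l z n) = norm (LINT t:{0<..}|lborel. exp (\<i> * z * of_real t) * wave l n t)"
    by (simp add: resolvent_def norm_mult)
  also have "\<dots> \<le> (LINT t:{0<..}|lborel. norm (exp (\<i> * z * of_real t) * wave l n t))"
    by (rule set_integral_norm_bound[OF int(1)])
  also have "\<dots> = A" by (simp add: A_def e_def norm_mult norm_exp_eq_Re)
  finally have rA: "cmod (resolvent l z n) \<le> A" .
  \<comment> \<open>The mean of \<open>cmod (wave l n t)\<close> under the probability density
    \<open>e * exp (- (e * t))\<close>; the inequality sought is nonnegativity of the
    variance.\<close>
  define s where "s = e * A"
  have "0 \<le> (LINT t:{0<..}|lborel. exp (- (e * t)) * (cmod (wave l n t) - s)\<^sup>2)"
    unfolding set_lebesgue_integral_def by (intro integral_nonneg_AE) (auto simp: indicator_def)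
  also have "(\<lambda>t. exp (- (e * t)) * (cmod (wave l n t) - s)\<^sup>2) =
      (\<lambda>t. exp (- (e * t)) * (cmod (wave l n t))\<^sup>2 - 2 * s * (exp (- (e * t)) * cmod (wave l n t)) + s\<^sup>2 * exp (- (e * t)))"
    by (rule ext) (simp add: power2_diff algebra_simps)
  also have "(LINT t:{0<..}|lborel. exp (- (e * t)) * (cmod (wave l n t))\<^sup>2 - 2 * s * (exp (- (e * t)) * cmod (wave l n t)) + s\<^sup>2 * exp (- (e * t)))
     = Q - 2 * s * A + s\<^sup>2 * (1 / e)"
    unfolding exp_decay_integral(2)[OF e, symmetric] Q_def A_def
    by (subst set_integral_add(2); (subst set_integral_diff(2))?)
      (intro set_integral_add(1) set_integral_diff(1) set_integrable_mult_right int exp_decay_integral(1)[OF e] | simp)+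
  also have "\<dots> = Q - e * A\<^sup>2" using e by (simp add: s_def power2_eq_square field_simps)
  finally have "e * A\<^sup>2 \<le> Q" by simp
  moreover have "(cmod (resolvent l z n))\<^sup>2 \<le> A\<^sup>2" using rA by (intro power_mono) auto
  ultimately show ?thesis using e unfolding Q_def e_def[symmetric] by (meson less_imp_le mult_left_mono order_trans)
qed

text \<open>With \<open>T = 2 / Im z\<close> the averaging weight is the one in
  \<open>resolvent_sq_le\<close>. One factor \<open>Im z\<close> comes from that bound, the other
  from the prefactor \<open>2 / T\<close>.\<close>

lemma time_average_ge_resolvent:
  assumes p: "p > 0" and z: "Im z > 0" and F: "finite F"
  shows "(Im z)\<^sup>2 * (\<Sum>n\<in>F. real_of_int \<bar>n\<bar> powr p * (cmod (resolvent l z n))\<^sup>2)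
    \<le> time_average (moment (fib_hamiltonian l) (delta 0) p) (2 / Im z)"
proof -
  define e where "e = Im z"
  have e: "e > 0" using z by (simp add: e_def)
  define M where "M = moment (fib_hamiltonian l) (delta 0) p"
  note int = wave_weighted_integrable(3)[OF z, of l, folded e_def]
  have "e * (\<Sum>n\<in>F. real_of_int \<bar>n\<bar> powr p * (cmod (resolvent l z n))\<^sup>2)
      = (\<Sum>n\<in>F. real_of_int \<bar>n\<bar> powr p * (e * (cmod (resolvent l z n))\<^sup>2))"
    by (simp add: sum_distrib_left mult_ac)
  also have "\<dots> \<le> (\<Sum>n\<in>F. real_of_int \<bar>n\<bar> powr p * (LINT t:{0<..}|lborel. exp (- (e * t)) * (cmod (wave l n t))\<^sup>2))"
    unfolding e_def by (intro sum_mono mult_left_mono resolvent_sq_le[OF z]) auto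
  also have "\<dots> = (LINT t:{0<..}|lborel. (\<Sum>n\<in>F. real_of_int \<bar>n\<bar> powr p * (exp (- (e * t)) * (cmod (wave l n t))\<^sup>2)))"
    unfolding set_integral_mult_right[symmetric] unfolding set_lebesgue_integral_def scaleR_sum_right
    using set_integrable_mult_right[OF int]
    by (intro Bochner_Integration.integral_sum[symmetric]) (simp add: set_integrable_def)
  also have "\<dots> \<le> (LINT t:{0<..}|lborel. exp (- (e * t)) * M t)"
  proof (rule set_integral_mono)
    show "set_integrable lborel {0<..} (\<lambda>t. \<Sum>n\<in>F. real_of_int \<bar>n\<bar> powr p * (exp (- (e * t)) * (cmod (wave l n t))\<^sup>2))"
      using set_integrable_mult_right[OF int] unfolding set_integrable_def scaleR_sum_right
      by (intro Bochner_Integration.integrable_sum)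
    show "set_integrable lborel {0<..} (\<lambda>t. exp (- (e * t)) * M t)"
      unfolding M_def by (rule moment_integrable[OF p e])
    fix t :: real assume t: "t \<in> {0<..}"
    have "(\<Sum>n\<in>F. real_of_int \<bar>n\<bar> powr p * (exp (- (e * t)) * (cmod (wave l n t))\<^sup>2)) = exp (- (e * t)) * (\<Sum>n\<in>F. moment_term l p n t)"
      by (simp add: sum_distrib_left moment_term_def mult_ac)
    also have "\<dots> \<le> exp (- (e * t)) * M t"
      unfolding M_def using t F p by (intro mult_left_mono sum_le_moment) auto
    finally show "(\<Sum>n\<in>F. real_of_int \<bar>n\<bar> powr p * (exp (- (e * t)) * (cmod (wave l n t))\<^sup>2)) \<le> exp (- (e * t)) * M t" .
  qed
  finally have "e * (e * (\<Sum>n\<in>F. real_of_int \<bar>n\<bar> powr p * (cmod (resolvent l z n))\<^sup>2))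
    \<le> e * (LINT t:{0<..}|lborel. exp (- (e * t)) * M t)"
    using e by (intro mult_left_mono) auto
  moreover have "time_average M (2 / e) = e * (LINT t:{0<..}|lborel. exp (- (e * t)) * M t)"
    using e by (simp add: time_average_def mult.commute)
  ultimately show ?thesis by (simp add: M_def e_def power2_eq_square mult.assoc)
qed

section \<open>Lower transport bound\<close>

lemma resolvent_solution_right:
  assumes "Im z > 0"
  shows "solution l z (\<lambda>n. resolvent l z (int n))"
  unfolding solution_def
proof
  fix n
  have alg: "a = (z - v) * c - b" if "a + b + (v - z) * c = 0" for a b c v :: complex
    using that by (simp add: algebra_simps eq_neg_iff_add_eq_0 eq_diff_eq)
  have "int (Suc n) + 1 = int (Suc (Suc n))" "int (Suc n) - 1 = int n" by simp_all
  with resolvent_equation[OF assms, of l "int (Suc n)"]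
  show "resolvent l z (int (Suc (Suc n))) =
      (z - of_real (fib_potential l (int (Suc n)))) * resolvent l z (int (Suc n)) - resolvent l z (int n)"
    using alg[of "resolvent l z (int (Suc (Suc n)))" "resolvent l z (int n)"] by (simp del: of_nat_Suc)
qed

lemma resolvent_solution_left:
  assumes "Im z > 0"
  shows "solution l z (\<lambda>n. resolvent l z (- int n - 1))"
  unfolding solution_def
proof
  fix n
  have alg: "b = (z - v) * c - a" if "a + b + (v - z) * c = 0" for a b c v :: complex
    using that by (simp add: algebra_simps eq_neg_iff_add_eq_0 eq_diff_eq)
  have eq: "- int (Suc n) - 1 + 1 = - int n - 1" "- int (Suc n) - 1 - 1 = - int (Suc (Suc n)) - 1"
    "(- int (Suc n) - 1 = 0) = False" by auto
  have V: "fib_potential l (- int (Suc n) - 1) = fib_potential l (int (Suc n))"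
    by (rule fib_potential_reflect) simp
  show "resolvent l z (- int (Suc (Suc n)) - 1) =
      (z - of_real (fib_potential l (int (Suc n)))) * resolvent l z (- int (Suc n) - 1) - resolvent l z (- int n - 1)"
    using resolvent_equation[OF assms, of l "- int (Suc n) - 1"] unfolding eq V if_False by (rule alg)
qed

text \<open>In the equation at the source the coefficients have total modulus at most
  \<open>1 + 1 + (l + 3)\<close>, so one of the three values is at least \<open>1 / (l + 5)\<close>.
  Sites 0, 1 start the right-hand solution and -1, -2 the reflected one.\<close>

lemma resolvent_initial_mass:
  assumes z: "Im z > 0" "cmod z \<le> l + 3" and l: "l > 0"
  shows "1 / (l + 5)\<^sup>2 \<le> (cmod (resolvent l z 0))\<^sup>2 + (cmod (resolvent l z 1))\<^sup>2
    \<or> 1 / (l + 5)\<^sup>2 \<le> (cmod (resolvent l z (- 1)))\<^sup>2 + (cmod (resolvent l z (- 2)))\<^sup>2"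
proof -
  define m where "m = 1 / (l + 5)"
  have m: "m > 0" "(l + 5) * m = 1" using l by (simp_all add: m_def)
  define r where "r = resolvent l z"
  have eq: "r 1 + r (- 1) - z * r 0 = 1"
    using resolvent_equation[OF z(1), of l 0] by (simp add: fib_potential_0 r_def)
  have "1 = cmod (r 1 + r (- 1) - z * r 0)" by (simp add: eq)
  also have "\<dots> \<le> cmod (r 1) + cmod (r (- 1)) + cmod z * cmod (r 0)"
    unfolding norm_mult[symmetric]
    by (intro order_trans[OF norm_triangle_ineq4] add_mono norm_triangle_ineq order_refl)
  also have "\<dots> \<le> cmod (r 1) + cmod (r (- 1)) + (l + 3) * cmod (r 0)"
    using z by (intro add_mono mult_right_mono) auto
  finally have *: "1 \<le> cmod (r 1) + cmod (r (- 1)) + (l + 3) * cmod (r 0)" .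
  have "m \<le> cmod (r 1) \<or> m \<le> cmod (r (- 1)) \<or> m \<le> cmod (r 0)"
  proof (rule ccontr)
    assume "\<not> ?thesis"
    then have "cmod (r 1) < m" "cmod (r (- 1)) < m" "(l + 3) * cmod (r 0) < (l + 3) * m" using l by auto
    then have "cmod (r 1) + cmod (r (- 1)) + (l + 3) * cmod (r 0) < (l + 5) * m" by (simp add: algebra_simps)
    then show False using * m by simp
  qed
  then have "m\<^sup>2 \<le> (cmod (r 1))\<^sup>2 \<or> m\<^sup>2 \<le> (cmod (r (- 1)))\<^sup>2 \<or> m\<^sup>2 \<le> (cmod (r 0))\<^sup>2"
    using m by (auto intro: power_mono)
  moreover have "0 \<le> (cmod (r 1))\<^sup>2" "0 \<le> (cmod (r 0))\<^sup>2" "0 \<le> (cmod (r (- 2)))\<^sup>2" by simp_all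
  ultimately have "m\<^sup>2 \<le> (cmod (r 0))\<^sup>2 + (cmod (r 1))\<^sup>2 \<or> m\<^sup>2 \<le> (cmod (r (- 1)))\<^sup>2 + (cmod (r (- 2)))\<^sup>2"
    by linarith
  then show ?thesis by (simp add: m_def r_def power_divide)
qed

lemma weighted_mass_lower_bound:
  fixes r :: "int \<Rightarrow> complex" and \<sigma> :: "nat \<Rightarrow> int"
  assumes w: "solution l z (\<lambda>n. r (\<sigma> n))" and J: "1 \<le> J"
    and t: "\<And>i. 1 \<le> i \<Longrightarrow> i \<le> J \<Longrightarrow> (cmod (fib_trace (of_real l) z (2 * i + 2)))\<^sup>2 \<le> 5"
    and p: "p > 0" and \<sigma>: "inj \<sigma>" "\<And>n. int n \<le> \<bar>\<sigma> n\<bar>"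
    and c: "c \<le> (cmod (r (\<sigma> 0)))\<^sup>2 + (cmod (r (\<sigma> 1)))\<^sup>2"
  shows "\<exists>F. finite F \<and> (phi ^ (2 * J)) powr p * ((17 / 16) ^ J / 7 * c) \<le> (\<Sum>n\<in>F. real_of_int \<bar>n\<bar> powr p * (cmod (r n))\<^sup>2)"
proof (intro exI conjI)
  define A where "A = {fib (2 * J + 2)..<fib (2 * J + 4)}"
  show "finite (\<sigma> ` A)" by (simp add: A_def)
  have ph: "0 \<le> phi ^ (2 * J)" using phi_pos by simp
  have "(17 / 16) ^ J / 7 * c \<le> (17 / 16) ^ J / 7 * ((cmod (r (\<sigma> 0)))\<^sup>2 + (cmod (r (\<sigma> 1)))\<^sup>2)"
    using c by (intro mult_left_mono) auto
  also have "\<dots> \<le> (\<Sum>n\<in>A. (cmod (r (\<sigma> n)))\<^sup>2)"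
    unfolding A_def by (rule solution_mass_lower_bound[OF w J t])
  finally have "(phi ^ (2 * J)) powr p * ((17 / 16) ^ J / 7 * c) \<le> (phi ^ (2 * J)) powr p * (\<Sum>n\<in>A. (cmod (r (\<sigma> n)))\<^sup>2)"
    by (intro mult_left_mono) auto
  also have "\<dots> = (\<Sum>n\<in>A. (phi ^ (2 * J)) powr p * (cmod (r (\<sigma> n)))\<^sup>2)"
    by (rule sum_distrib_left)
  also have "\<dots> \<le> (\<Sum>n\<in>A. real_of_int \<bar>\<sigma> n\<bar> powr p * (cmod (r (\<sigma> n)))\<^sup>2)"
  proof (intro sum_mono mult_right_mono powr_mono2)
    fix n assume "n \<in> A"
    then have "real (fib (2 * J + 2)) \<le> real n" by (simp add: A_def del: fib.simps)
    moreover have "phi ^ (2 * J) \<le> real (fib (2 * J + 2))" using phi_power_le_fib[of "2 * J"] by simp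
    moreover have "real n \<le> real_of_int \<bar>\<sigma> n\<bar>" using \<sigma>(2)[of n] by linarith
    ultimately show "phi ^ (2 * J) \<le> real_of_int \<bar>\<sigma> n\<bar>" by linarith
  qed (use p ph in auto)
  also have "\<dots> = (\<Sum>n\<in>\<sigma> ` A. real_of_int \<bar>n\<bar> powr p * (cmod (r n))\<^sup>2)"
    using \<sigma>(1) by (subst sum.reindex) (auto simp: inj_on_def)
  finally show "(phi ^ (2 * J)) powr p * ((17 / 16) ^ J / 7 * c) \<le> (\<Sum>n\<in>\<sigma> ` A. real_of_int \<bar>n\<bar> powr p * (cmod (r n))\<^sup>2)" .
qed

lemma time_average_moment_lower_bound:
  fixes l p e :: real
  assumes l: "l > 4" and p: "p > 0" and J: "1 \<le> J" and e: "0 < e" "e \<le> 1" "e * S_u l ^ J \<le> 1 / (l + 12)"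
  shows "e\<^sup>2 * ((phi ^ (2 * J)) powr p * ((17 / 16) ^ J / 7 * (1 / (l + 5)\<^sup>2)))
     \<le> time_average (moment (fib_hamiltonian l) (delta 0) p) (2 / e)"
proof -
  obtain E where E: "\<bar>E\<bar> \<le> l + 2" "\<And>i. i \<le> J \<Longrightarrow> \<bar>fib_trace l E (2 * i + 2)\<bar> \<le> 2"
    using ex_bounded_traces[OF l, of J] by blast
  define z where "z = complex_of_real E + \<i> * complex_of_real e"
  have z: "Im z = e" "Im z > 0" using e by (simp_all add: z_def)
  have "cmod z \<le> \<bar>E\<bar> + e"
    unfolding z_def using norm_triangle_ineq[of "complex_of_real E" "\<i> * complex_of_real e"] e by (simp add: norm_mult)
  then have zl: "cmod z \<le> l + 3" using E e by linarith
  have S: "S_u l \<ge> 1" using l by (simp add: S_u_def)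
  have t: "(cmod (fib_trace (of_real l) z (2 * i + 2)))\<^sup>2 \<le> 5" if "1 \<le> i" "i \<le> J" for i
  proof -
    have "e * S_u l ^ i \<le> e * S_u l ^ J" using S e that by (intro mult_left_mono power_increasing) auto
    also have "\<dots> \<le> 1 / (l + 12)" by (rule e(3))
    also have "\<dots> \<le> 1 / 12" using l by simp
    finally have "cmod (fib_trace (of_real l) z (2 * i + 2) - fib_trace l E (2 * i + 2)) \<le> 1 / 12"
      using fib_trace_perturbation[OF l E(2) less_imp_le[OF e(1)] e(3) that(2)] unfolding z_def by fastforce
    moreover have "cmod (fib_trace l E (2 * i + 2)) \<le> 2" using E(2)[OF that(2)] by simp
    ultimately have "cmod (fib_trace (of_real l) z (2 * i + 2)) \<le> 25 / 12"
      using norm_triangle_sub[of "fib_trace (complex_of_real l) z (2 * i + 2)" "complex_of_real (fib_trace l E (2 * i + 2))"]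
      by linarith
    \<comment> \<open>The square of \<open>2 + 1/12\<close> stays below 5, the threshold of the
      block inequality.\<close>
    then have "(cmod (fib_trace (of_real l) z (2 * i + 2)))\<^sup>2 \<le> (25 / 12)\<^sup>2" by (intro power_mono) auto
    then show ?thesis by (simp add: power2_eq_square)
  qed
  define c where "c = 1 / (l + 5)\<^sup>2"
  have initial: "c \<le> (cmod (resolvent l z 0))\<^sup>2 + (cmod (resolvent l z 1))\<^sup>2
      \<or> c \<le> (cmod (resolvent l z (- 1)))\<^sup>2 + (cmod (resolvent l z (- 2)))\<^sup>2"
    using resolvent_initial_mass[OF z(2) zl] l by (simp add: c_def)
  have "\<exists>F. finite F \<and> (phi ^ (2 * J)) powr p * ((17 / 16) ^ J / 7 * c)
      \<le> (\<Sum>n\<in>F. real_of_int \<bar>n\<bar> powr p * (cmod (resolvent l z n))\<^sup>2)"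
    using initial
  proof
    assume "c \<le> (cmod (resolvent l z 0))\<^sup>2 + (cmod (resolvent l z 1))\<^sup>2"
    then show ?thesis
      by (intro weighted_mass_lower_bound[where r = "resolvent l z" and \<sigma> = int, OF resolvent_solution_right[OF z(2)] J t p]) (auto simp: inj_def)
  next
    assume "c \<le> (cmod (resolvent l z (- 1)))\<^sup>2 + (cmod (resolvent l z (- 2)))\<^sup>2"
    then show ?thesis
      by (intro weighted_mass_lower_bound[where r = "resolvent l z" and \<sigma> = "\<lambda>n. - int n - 1",
            OF resolvent_solution_left[OF z(2)] J t p]) (auto simp: inj_def)
  qed
  then obtain F where F: "finite F" "(phi ^ (2 * J)) powr p * ((17 / 16) ^ J / 7 * c)
      \<le> (\<Sum>n\<in>F. real_of_int \<bar>n\<bar> powr p * (cmod (resolvent l z n))\<^sup>2)" by blast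
  have "e\<^sup>2 * ((phi ^ (2 * J)) powr p * ((17 / 16) ^ J / 7 * c))
     \<le> e\<^sup>2 * (\<Sum>n\<in>F. real_of_int \<bar>n\<bar> powr p * (cmod (resolvent l z n))\<^sup>2)"
    using F(2) by (intro mult_left_mono) auto
  also have "\<dots> \<le> time_average (moment (fib_hamiltonian l) (delta 0) p) (2 / e)"
    using time_average_ge_resolvent[OF p z(2) F(1)] unfolding z(1) .
  finally show ?thesis by (simp only: c_def)
qed

text \<open>
  The growth rate \<open>17/16\<close> per double step is larger than the rate \<open>(17/16) powr (2/5)\<close> of the
  statement, and the surplus swallows all multiplicative constants.
\<close>

theorem theorem4:
  fixes l p :: real
  assumes "l > sqrt 24" and "p > 0"
  shows "lower_transport_exponent (fib_hamiltonian l) (delta 0) p \<ge>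
    ereal (2 * ln phi / ln (S_u l)
      - 2 / p * (1 - 2 * ln (sqrt 17 / 4) / (5 * ln (S_u l))))"
proof -
  have "sqrt 16 < sqrt 24" by (rule real_sqrt_less_mono) simp
  then have l: "l > 4" using assms(1) by simp
  note p = \<open>p > 0\<close>
  define s where "s = ln (S_u l)"
  define h :: real where "h = ln (17 / 16)"
  define f where "f = ln phi"
  have S: "S_u l > 1" using l by (simp add: S_u_def)
  have pos: "s > 0" "h > 0" "f > 0" using S phi_pos by (simp_all add: s_def h_def f_def)
  have half: "ln (sqrt 17 / 4) = h / 2"
  proof -
    have "h = ln ((sqrt 17 / 4)\<^sup>2)" by (simp add: h_def power_divide)
    also have "\<dots> = 2 * ln (sqrt 17 / 4)" by (subst ln_realpow) auto
    finally show ?thesis by simp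
  qed
  \<comment> \<open>The logarithmic offset of the admissibility condition
    \<open>S_u l ^ J \<le> T / (2 * (l + 12))\<close>, which is
    \<open>e * S_u l ^ J \<le> 1 / (l + 12)\<close> at \<open>e = 2 / T\<close>.\<close>
  define a where "a = - ln (2 * (l + 12))"
  \<comment> \<open>All terms of the lower bound that do not grow with \<open>ln T\<close>,
    including the loss from rounding \<open>J\<close> down.\<close>
  define B where "B = (a / s - 1) * (2 * p * f + h) + 2 * ln 2 - ln (7 * (l + 5)\<^sup>2)"
  \<comment> \<open>In this order: \<open>J\<close> is at least 1, the surplus outweighs
    \<open>B\<close>, and \<open>e \<le> 1\<close> with \<open>ln T > 0\<close>.\<close>
  have ev: "\<forall>\<^sub>F T in at_top. 2 * s - a \<le> ln T \<and> - B * 5 * s / (3 * h) \<le> ln T \<and> 2 \<le> T"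
    using filterlim_at_top[THEN iffD1, OF ln_at_top] by (intro eventually_conj eventually_ge_at_top) auto
  have "\<forall>\<^sub>F T in at_top. ereal (2 * f / s - 2 / p * (1 - 2 * (h / 2) / (5 * s)))
      \<le> ereal (ln (time_average (moment (fib_hamiltonian l) (delta 0) p) T) / (p * ln T))"
    using ev
  proof eventually_elim
    case (elim T)
    define L where "L = ln T"
    have L: "2 * s - a \<le> L" "- B * 5 * s / (3 * h) \<le> L" "0 < L" and T: "2 \<le> T"
      using elim by (auto simp: L_def)
    define e where "e = 2 / T"
    have e: "0 < e" "e \<le> 1" "2 / e = T" "ln e = ln 2 - L" using T by (auto simp: e_def L_def ln_div)
    define J where "J = nat \<lfloor>(L + a) / s\<rfloor>"
    have "(L + a) / s \<ge> 2" using L pos by (simp add: field_simps)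
    then have J: "1 \<le> J" "real J \<le> (L + a) / s" "(L + a) / s - 1 \<le> real J" unfolding J_def by linarith+
    have "ln (S_u l ^ J) = real J * s" using S by (simp add: ln_realpow s_def)
    also have "\<dots> \<le> L + a" using J(2) pos by (simp add: field_simps)
    also have "\<dots> = ln (T / (2 * (l + 12)))" using T l by (simp add: L_def a_def ln_div)
    finally have "S_u l ^ J \<le> T / (2 * (l + 12))" using S T l by (subst (asm) ln_le_cancel_iff) auto
    then have eS: "e * S_u l ^ J \<le> 1 / (l + 12)" using T l by (simp add: e_def field_simps)
    define X where "X = e\<^sup>2 * ((phi ^ (2 * J)) powr p * ((17 / 16) ^ J / 7 * (1 / (l + 5)\<^sup>2)))"
    have X: "X > 0" "X \<le> time_average (moment (fib_hamiltonian l) (delta 0) p) T"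
      using time_average_moment_lower_bound[OF l p J(1) e(1,2) eS] e phi_pos l unfolding X_def by auto
    have "ln X = ln (e\<^sup>2) + (ln ((phi ^ (2 * J)) powr p) + ln ((17 / 16) ^ J / (7 * (l + 5)\<^sup>2)))"
    proof -
      have *: "ln (x * (y * w)) = ln x + (ln y + ln w)" if "x > 0" "y > 0" "w > 0" for x y w :: real
        using that by (simp add: ln_mult_pos)
      have "X = e\<^sup>2 * ((phi ^ (2 * J)) powr p * ((17 / 16) ^ J / (7 * (l + 5)\<^sup>2)))"
        by (simp add: X_def)
      then show ?thesis using e phi_pos l by (simp only:, intro *) auto
    qed
    also have "ln (e\<^sup>2) = 2 * (ln 2 - L)" using e by (simp add: ln_realpow)
    also have "ln ((phi ^ (2 * J)) powr p) = real J * (2 * p * f)" using phi_pos by (simp add: ln_powr ln_realpow f_def)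
    also have "ln ((17 / 16) ^ J / (7 * (l + 5)\<^sup>2)) = real J * h - ln (7 * (l + 5)\<^sup>2)"
      using l by (simp add: ln_div ln_realpow h_def)
    finally have lnX: "ln X = real J * (2 * p * f + h) + 2 * ln 2 - 2 * L - ln (7 * (l + 5)\<^sup>2)"
      by (simp add: algebra_simps)
    have "((L + a) / s - 1) * (2 * p * f + h) \<le> real J * (2 * p * f + h)"
      using J(3) pos p by (intro mult_right_mono) auto
    then have "L / s * (2 * p * f + h) - 2 * L + B \<le> ln X"
      unfolding lnX B_def by (simp add: add_divide_distrib algebra_simps)
    \<comment> \<open>The mass grows at rate \<open>h\<close> per step while the claim asks for
      \<open>2 * h / 5\<close>; the remaining \<open>3 * h / 5\<close> pays for
      \<open>B\<close>.\<close>
    moreover have "- B \<le> 3 * h / (5 * s) * L" using L(2) pos by (simp add: field_simps)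
    ultimately have "L / s * (2 * p * f + h) - 2 * L - 3 * h / (5 * s) * L \<le> ln X" by linarith
    also have "ln X \<le> ln (time_average (moment (fib_hamiltonian l) (delta 0) p) T)"
      using X by (subst ln_le_cancel_iff) auto
    also have "L / s * (2 * p * f + h) - 2 * L - 3 * h / (5 * s) * L
        = (2 * f / s - 2 / p * (1 - 2 * (h / 2) / (5 * s))) * (p * L)"
      using pos(1) p by (simp add: field_simps)
    finally have "(2 * f / s - 2 / p * (1 - 2 * (h / 2) / (5 * s))) * (p * L)
        \<le> ln (time_average (moment (fib_hamiltonian l) (delta 0) p) T)" .
    then show ?case
      using p L by (simp add: pos_le_divide_eq L_def)
  qed
  then show ?thesis
    unfolding lower_transport_exponent_def half f_def[symmetric] s_def[symmetric] by (rule Liminf_bounded)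
qed

end
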